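(* Let $k\ge1$ be an integer and let $\alpha,\beta>0$ satisfy $\alpha\beta=\pi^{2}$. Then \begin{align*} &\alpha^{\frac{k}{2}}\left\{ 2\eta_{k-1}\left(\tfrac{k}{2}\right)+2\gamma-4\log\Phi_k-2\log\left(4\beta\right)+2\sum_{m,n=1}^{\infty}r_{k}(m)\,r_{k}(n)\,K_{0}\left(2\sqrt{mn}\,\alpha\right)\right\}\\ &=\beta^{\frac{k}{2}}\left\{ 2 \eta_{k-1}\left(\tfrac{k}{2}\right)+2\gamma-4\log\Phi_k-2\log\left(4\alpha\right)+2\sum_{m,n=1}^{\infty}r_{k}(m)\,r_{k}(n)\,K_{0}\left(2\sqrt{mn}\,\beta\right)\right\}, \end{align*} where $\Phi_k:=\prod_{\mathbf{m}\in\mathbb{Z}^{k-1}\setminus\{\mathbf{0}\}}\left(1-e^{-2\pi|\mathbf{m}|}\right)$.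
   Context: For integers $j\geq1$ and $n\geq 0$, $r_j(n)$ is the number of $(n_1,\dots,n_j)\in\mathbb{Z}^j$ with $n_1^2+\dots+n_j^2=n$, $\zeta_j(s)=\sum_{n=1}^\infty r_j(n)n^{-s}$ for $\mathrm{Re}(s)>j/2$, and $\eta_j(s):=\pi^{-s}\Gamma(s)\zeta_j(s)$; thus $\eta_{k-1}(k/2)=\pi^{-k/2}\Gamma(k/2)\zeta_{k-1}(k/2)$. Conventions for $k=1$: $\zeta_0=\eta_0:=0$ and the empty product $\Phi_1:=1$. $|\mathbf{m}|$ is the Euclidean norm, $\gamma$ the Euler–Mascheroni constant, and $K_0$ the modified Bessel function of the second kind. *)

theory Defs
  imports "HOL-Analysis.Analysis"
begin

definition r_sq :: "nat \<Rightarrow> nat \<Rightarrow> nat" where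
  "r_sq j n = card {v :: int list. length v = j \<and> (\<Sum>x\<leftarrow>v. x ^ 2) = int n}"

text \<open>zeta_j(s) = sum over n >= 1 of r_j(n) n^(-s), at real s (used for s > j/2).\<close>
definition zeta_sq :: "nat \<Rightarrow> real \<Rightarrow> real" where
  "zeta_sq j s = (\<Sum>n. real (r_sq j (Suc n)) / real (Suc n) powr s)"

text \<open>eta_j(s) = pi^(-s) Gamma(s) zeta_j(s). For j = 0 this is 0 since r_0(n) = 0 for n >= 1.\<close>
definition eta_sq :: "nat \<Rightarrow> real \<Rightarrow> real" where
  "eta_sq j s = pi powr (- s) * Gamma s * zeta_sq j s"

definition besselK0 :: "real \<Rightarrow> real" where
  "besselK0 x = integral {0..} (\<lambda>t. exp (- x * cosh t))"

definition int_vec_norm :: "int list \<Rightarrow> real" where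
  "int_vec_norm v = sqrt (real_of_int (\<Sum>x\<leftarrow>v. x ^ 2))"

text \<open>Phi_k = product over nonzero m in Z^(k-1) of (1 - exp(-2 pi |m|)), defined as the
  limit of the finite partial products over the boxes max|m_i| <= N.  Empty product for k = 1.\<close>
definition Phi :: "nat \<Rightarrow> real" where
  "Phi k = lim (\<lambda>N::nat. \<Prod>v \<in> {v :: int list. length v = k - 1 \<and> v \<noteq> replicate (k - 1) 0
                                   \<and> (\<forall>x\<in>set v. \<bar>x\<bar> \<le> int N)}.
                  (1 - exp (- 2 * pi * int_vec_norm v)))"

end

theory Submission
  imports Defs "HOL-Probability.Distributions"
begin

text \<open>
  In the variable t = log x, put G(t) = theta(e^t)^k. The double series is half of the integral of
  (G(l + t) - 1) (G(l - t) - 1) over the real line, where alpha = pi e^l. The functional equation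
  G(-t) = e^(kt/2) G(t) turns this integral at l into the one at -l up to elementary terms and
  multiples of the constant W, the integral of G minus its asymptotics at both ends. It remains to
  identify W - 2/k with eta_(k-1)(k/2) - 2 log Phi_k + gamma - log (4 pi). Applying the functional
  equation to k - 1 of the k theta factors reduces this to k = 1: the cross terms are Bessel functions of order 1/2, hence
  elementary, and sum to -2 log Phi_k. For k = 1 the constant is the finite part at s = 0 of
  2 pi^(-1/2-s) Gamma(1/2+s) zeta(1+2s).
  The functional equation itself follows from uniqueness of Laplace transforms: both sides transform
  to a hyperbolic cotangent, one through its partial fraction expansion and the other through a
  geometric series.
\<close>

section \<open>Infinite sums and lattice points\<close>

text \<open>The obstacle is that every exchange of sum and integral has to be justified, while W
  converges only after a subtraction. The way out is that everything that gets expanded is a product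
  of nonnegative factors such as G - 1 or theta - 1, so Tonelli suffices: finiteness on one side,
  from exponential bounds or from a known series, yields it on the other. The logarithmic variable
  turns x -> 1/x into t -> -t and keeps Lebesgue measure invariant under shifts, so all shifted and
  reflected copies of the regularised G have the same integral W. The double integral can be
  reflected because G(l + t) G(l - t) equals e^(-kl) G(-l + t) G(-l - t): in the difference of the
  two integrals only terms linear in G survive. Origin of the constants: for k = 1 the zeta factor
  contributes 2 gamma, the Gamma factor contributes Digamma(1/2) - log pi = -gamma - log (4 pi), and
  the elementary part contributes 2, which is 2/k at k = 1.\<close>

lemma nn_integral_count_space_eq_ennreal_iff:
  fixes f :: "'i \<Rightarrow> real"
  assumes "\<And>i. i \<in> I \<Longrightarrow> 0 \<le> f i" and "0 \<le> S"
  shows "(\<integral>\<^sup>+i. ennreal (f i) \<partial>count_space I) = ennreal S \<longleftrightarrow> (f has_sum S) I"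
proof -
  have *: "(\<integral>\<^sup>+i. ennreal (f i) \<partial>count_space I) = ennreal (infsum f I)" if "f summable_on I"
  proof -
    have "Infinite_Set_Sum.abs_summable_on f I"
      using that by (metis abs_summable_equivalent summable_on_iff_abs_summable_on_real)
    then have "integrable (count_space I) f" "lebesgue_integral (count_space I) f = infsum f I"
      using infsetsum_infsum[of f I] by (auto simp: abs_summable_on_def infsetsum_def)
    then show ?thesis
      by (subst nn_integral_eq_integral) (use assms in \<open>auto simp: AE_count_space\<close>)
  qed
  show ?thesis
  proof
    assume eq: "(\<integral>\<^sup>+i. ennreal (f i) \<partial>count_space I) = ennreal S"
    have "integrable (count_space I) f"
      by (rule integrableI_nn_integral_finite[OF _ _ eq]) (use assms in \<open>auto simp: AE_count_space\<close>)
    then have "Infinite_Set_Sum.abs_summable_on f I" by (simp add: abs_summable_on_def)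
    then have sm: "f summable_on I"
      by (metis abs_summable_equivalent summable_on_iff_abs_summable_on_real)
    moreover have "infsum f I \<ge> 0" by (rule infsum_nonneg) (use assms in auto)
    ultimately have "infsum f I = S" using *[OF sm] eq assms by simp
    with sm show "(f has_sum S) I" by (simp add: has_sum_iff)
  next
    assume "(f has_sum S) I"
    then show "(\<integral>\<^sup>+i. ennreal (f i) \<partial>count_space I) = ennreal S"
      using * by (auto simp: has_sum_iff)
  qed
qed

section \<open>Tonelli for nonnegative families\<close>

context
  fixes M :: "'a measure" and f :: "'i \<Rightarrow> 'a \<Rightarrow> real" and I c F
  assumes I: "countable I"
    and f: "\<And>i. i \<in> I \<Longrightarrow> has_bochner_integral M (f i) (c i)"
    and nonneg: "\<And>i x. i \<in> I \<Longrightarrow> 0 \<le> f i x"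
    and F: "\<And>x. ((\<lambda>i. f i x) has_sum F x) I" "F \<in> borel_measurable M"
begin

lemma nn_integral_eq_count_space_integrals:
  "(\<integral>\<^sup>+x. ennreal (F x) \<partial>M) = (\<integral>\<^sup>+i. ennreal (c i) \<partial>count_space I)"
proof -
  have Fnn: "0 \<le> F x" for x using F(1)[of x] by (rule has_sum_nonneg) (use nonneg in auto)
  have "(\<integral>\<^sup>+x. ennreal (F x) \<partial>M) = (\<integral>\<^sup>+x. \<integral>\<^sup>+i. ennreal (f i x) \<partial>count_space I \<partial>M)"
  proof (rule nn_integral_cong)
    fix x
    show "ennreal (F x) = (\<integral>\<^sup>+i. ennreal (f i x) \<partial>count_space I)"
      using nn_integral_count_space_eq_ennreal_iff[of I "\<lambda>i. f i x" "F x"] F nonneg Fnn by metis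
  qed
  also have "\<dots> = (\<integral>\<^sup>+i. \<integral>\<^sup>+x. ennreal (f i x) \<partial>M \<partial>count_space I)"
  proof (rule nn_integral_count_space_nn_integral[OF I])
    fix i assume "i \<in> I"
    from f[OF this] show "(\<lambda>x. ennreal (f i x)) \<in> borel_measurable M"
      by (auto simp: has_bochner_integral_iff)
  qed
  also have "\<dots> = (\<integral>\<^sup>+i. ennreal (c i) \<partial>count_space I)"
  proof (rule nn_integral_cong)
    fix i assume "i \<in> space (count_space I)"
    then have i: "i \<in> I" by simp
    show "(\<integral>\<^sup>+x. ennreal (f i x) \<partial>M) = ennreal (c i)"
      using f[OF i] nonneg[OF i] by (auto simp: has_bochner_integral_iff nn_integral_eq_integral)
  qed
  finally show ?thesis .
qed

text \<open>Both directions are needed. From left to right, a finite integral yields convergence of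
  the series (the Bessel double series, \<open>eta_sq\<close>, \<open>Phi\<close>); from right to
  left, a series with known sum yields integrability of its pointwise sum (the Laplace transforms of
  theta, the zeta integral).\<close>

lemma has_bochner_integral_has_sum_iff:
  "has_bochner_integral M F S \<longleftrightarrow> (c has_sum S) I"
proof -
  have Fnn: "0 \<le> F x" for x using F(1)[of x] by (rule has_sum_nonneg) (use nonneg in auto)
  have cnn: "0 \<le> c i" if "i \<in> I" for i
    using f[OF that] nonneg[OF that] Bochner_Integration.integral_nonneg[of M "f i"]
    by (auto simp: has_bochner_integral_iff)
  show ?thesis
  proof
    assume h: "has_bochner_integral M F S"
    \<comment> \<open>The sign of \<open>S\<close> is settled before the comparison because
      \<open>ennreal\<close> sends all negative numbers to 0.\<close>
    then have S: "0 \<le> S" using Fnn by (auto simp: has_bochner_integral_iff)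
    have "(\<integral>\<^sup>+x. ennreal (F x) \<partial>M) = ennreal S"
      using h Fnn by (auto simp: has_bochner_integral_iff nn_integral_eq_integral)
    then show "(c has_sum S) I"
      using nn_integral_count_space_eq_ennreal_iff[of I c S] cnn S nn_integral_eq_count_space_integrals by auto
  next
    assume h: "(c has_sum S) I"
    then have S: "0 \<le> S" by (rule has_sum_nonneg) (use cnn in auto)
    have "(\<integral>\<^sup>+x. ennreal (F x) \<partial>M) = ennreal S"
      using nn_integral_count_space_eq_ennreal_iff[of I c S] cnn S nn_integral_eq_count_space_integrals h by auto
    then show "has_bochner_integral M F S"
      by (intro has_bochner_integral_nn_integral) (use F Fnn S in auto)
  qed
qed

end

section \<open>Sums over Z and over integer lists\<close>

lemma has_sum_even_int:
  fixes g :: "int \<Rightarrow> real"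
  assumes "((\<lambda>n::nat. g (int n)) has_sum S) {1..}" and even: "\<And>n. g (- n) = g n"
  shows "(g has_sum (g 0 + 2 * S)) UNIV"
proof -
  have 1: "(g has_sum S) (int ` {1..})"
    using assms(1) by (subst has_sum_reindex) (auto simp: o_def)
  have "(g has_sum S) ((\<lambda>n. - int n) ` {1..})"
    using assms by (subst has_sum_reindex) (auto simp: o_def inj_on_def)
  moreover have "int ` {1..} \<inter> (\<lambda>n. - int n) ` {1..} = {}" by auto
  ultimately have 2: "(g has_sum S + S) (int ` {1..} \<union> (\<lambda>n. - int n) ` {1..})"
    by (rule has_sum_Un_disjoint[OF 1])
  have 0: "(g has_sum g 0) {0}" by (rule has_sum_finiteI) auto
  have "{0} \<inter> (int ` {1..} \<union> (\<lambda>n. - int n) ` {1..}) = {}" by auto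
  from has_sum_Un_disjoint[OF 0 2 this]
  have "(g has_sum (g 0 + (S + S))) ({0} \<union> (int ` {1..} \<union> (\<lambda>n. - int n) ` {1..}))" .
  moreover have "{0} \<union> (int ` {1..} \<union> (\<lambda>n. - int n) ` {1..}) = UNIV"
  proof -
    have "x \<in> {0} \<union> (int ` {1..} \<union> (\<lambda>n. - int n) ` {1..})" for x
    proof (cases x)
      case (nonneg n)
      then show ?thesis by (cases "n = 0") auto
    next
      case (neg n)
      then have "x = - int (Suc n)" by simp
      then show ?thesis by (intro UnI2) (rule image_eqI[where x="Suc n"], auto)
    qed
    then show ?thesis by auto
  qed
  ultimately show ?thesis by (simp only: mult_2)
qed

lemma has_sum_product_nonneg:
  fixes f :: "'a \<Rightarrow> real" and g :: "'b \<Rightarrow> real"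
  assumes "(f has_sum S) A" "(g has_sum T) B"
    and "\<And>x. x \<in> A \<Longrightarrow> 0 \<le> f x" "\<And>y. y \<in> B \<Longrightarrow> 0 \<le> g y"
  shows "((\<lambda>(x, y). f x * g y) has_sum (S * T)) (A \<times> B)"
proof (rule has_sum_SigmaI[where g="\<lambda>x. f x * T"])
  show "((\<lambda>y. case (x, y) of (x, y) \<Rightarrow> f x * g y) has_sum f x * T) B" for x
    using has_sum_cmult_right[OF assms(2)] by simp
  show h: "((\<lambda>x. f x * T) has_sum S * T) A"
    using has_sum_cmult_left[OF assms(1)] by simp
  show "(\<lambda>(x, y). f x * g y) summable_on A \<times> B"
  proof (rule summable_on_SigmaI[where g="\<lambda>x. f x * T"])
    show "((\<lambda>y. case (x, y) of (x, y) \<Rightarrow> f x * g y) has_sum f x * T) B" for x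
      using has_sum_cmult_right[OF assms(2)] by simp
    show "(\<lambda>x. f x * T) summable_on A" using h has_sum_imp_summable by blast
  qed (use assms in auto)
qed

text \<open>Induction on the length: a nonempty list is its head together with its tail, so one more
  factor \<open>S\<close> is one more coordinate. This turns a power of theta into a sum over
  Z^j.\<close>

lemma has_sum_lists_power:
  fixes g :: "int \<Rightarrow> real"
  assumes "(g has_sum S) UNIV" and nonneg: "\<And>n. 0 \<le> g n"
  shows "((\<lambda>v. \<Prod>n\<leftarrow>v. g n) has_sum S ^ j) {v. length v = j}"
proof (induction j)
  case 0
  have "{v::int list. length v = 0} = {[]}" by auto
  then show ?case by (auto intro: has_sum_finiteI)
next
  case (Suc j)
  have nn: "0 \<le> (\<Prod>n\<leftarrow>v. g n)" for v by (induction v) (use nonneg in auto)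
  have "((\<lambda>(n, v). g n * (\<Prod>n\<leftarrow>v. g n)) has_sum S * S ^ j) (UNIV \<times> {v. length v = j})"
    by (rule has_sum_product_nonneg[OF assms(1) Suc]) (use nonneg nn in auto)
  also have "?this \<longleftrightarrow> ((\<lambda>v. \<Prod>n\<leftarrow>v. g n) has_sum S * S ^ j) {v. length v = Suc j}"
    by (rule has_sum_reindex_bij_witness[where i="\<lambda>v. (hd v, tl v)" and j="\<lambda>(n, v). n # v"])
       (auto simp: length_Suc_conv)
  finally show ?case by simp
qed

section \<open>Lattice points graded by squared norm\<close>

definition sqnorm :: "int list \<Rightarrow> nat" where
  "sqnorm v = nat (\<Sum>x\<leftarrow>v. x ^ 2)"

lemma int_sqnorm: "int (sqnorm v) = (\<Sum>x\<leftarrow>v. x ^ 2)"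
proof -
  have "0 \<le> (\<Sum>x\<leftarrow>v. x ^ 2)" by (induction v) auto
  then show ?thesis by (simp add: sqnorm_def)
qed

lemma sqnorm_Nil [simp]: "sqnorm [] = 0"
  by (simp add: sqnorm_def)

lemma sqnorm_Cons [simp]: "int (sqnorm (x # v)) = x ^ 2 + int (sqnorm v)"
  by (simp add: int_sqnorm)

lemma int_vec_norm_eq: "int_vec_norm v = sqrt (sqnorm v)"
  unfolding int_vec_norm_def int_sqnorm[symmetric] by simp

lemma sqnorm_eq_0_iff: "sqnorm v = 0 \<longleftrightarrow> v = replicate (length v) 0"
proof (induction v)
  case (Cons x v)
  have "sqnorm (x # v) = 0 \<longleftrightarrow> int (sqnorm (x # v)) = 0" by linarith
  also have "\<dots> \<longleftrightarrow> x = 0 \<and> sqnorm v = 0"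
    by (simp add: add_nonneg_eq_0_iff)
  finally show ?case using Cons by simp
qed auto

lemma r_sq_eq_card: "r_sq j n = card {v. length v = j \<and> sqnorm v = n}"
  unfolding r_sq_def by (intro arg_cong[where f=card]) (auto simp flip: int_sqnorm)

lemma abs_le_sqnorm: "x \<in> set v \<Longrightarrow> \<bar>x\<bar> \<le> int (sqnorm v)"
proof (induction v)
  case (Cons y v)
  have "\<bar>y\<bar> \<le> y ^ 2" using self_le_power[of "\<bar>y\<bar>" 2] by (cases "y = 0") auto
  then show ?case using Cons by (auto intro: add_increasing)
qed auto

lemma finite_sqnorm_eq: "finite {v. length v = j \<and> sqnorm v = n}"
proof (rule finite_subset)
  show "{v. length v = j \<and> sqnorm v = n} \<subseteq> {v. set v \<subseteq> {- int n..int n} \<and> length v = j}"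
    using abs_le_sqnorm by (force simp: abs_le_iff)
qed (rule finite_lists_length_eq, simp)

text \<open>Regroups a sum over lattice points by the value of \<open>sqnorm\<close>; each fibre is
  finite and contributes its cardinality. The set \<open>A\<close> makes it possible to leave out
  the zero vector.\<close>

lemma has_sum_r_sq:
  fixes f :: "nat \<Rightarrow> real"
  assumes "((\<lambda>v. f (sqnorm v)) has_sum S) {v. length v = j \<and> sqnorm v \<in> A}"
  shows "((\<lambda>n. real (r_sq j n) * f n) has_sum S) A"
proof (rule has_sum_SigmaD)
  show "((\<lambda>(n, v). f n) has_sum S) (Sigma A (\<lambda>n. {v. length v = j \<and> sqnorm v = n}))"
    using assms
    by (subst has_sum_reindex_bij_witness[where i="\<lambda>v. (sqnorm v, v)" and j=snd]) auto
  show "((\<lambda>v. case (n, v) of (n, v) \<Rightarrow> f n) has_sum real (r_sq j n) * f n)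
      {v. length v = j \<and> sqnorm v = n}" for n
    by (rule has_sum_finiteI) (auto simp: finite_sqnorm_eq r_sq_eq_card)
qed

section \<open>Integrals of Bessel type\<close>

text \<open>The change of variables theorem speaks of absolute integrability. Nonnegativity of
  \<open>f\<close> on the range provides it, and the nonnegative integral then carries the result
  over to \<open>lborel\<close>.\<close>

lemma has_bochner_integral_substitution_nonneg:
  fixes f g :: "real \<Rightarrow> real"
  assumes f: "(f has_integral r) (range g)" "\<And>x. 0 \<le> f (g x)"
    and g: "\<And>x. (g has_real_derivative g' x) (at x)" "inj g"
    and [measurable]: "g' \<in> borel_measurable borel" "f \<in> borel_measurable borel"
  shows "has_bochner_integral lborel (\<lambda>x. \<bar>g' x\<bar> * f (g x)) r"
proof -
  have cont: "continuous_on UNIV g"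
    using g(1) by (meson DERIV_isCont continuous_at_imp_continuous_on)
  then have [measurable]: "g \<in> borel_measurable borel"
    by (rule borel_measurable_continuous_onI)
  have "f absolutely_integrable_on (range g)" "integral (range g) f = r"
    using f by (auto intro!: nonnegative_absolutely_integrable_1 simp: has_integral_iff)
  then have *: "(\<lambda>x. \<bar>g' x\<bar> * f (g x)) absolutely_integrable_on UNIV"
    "integral UNIV (\<lambda>x. \<bar>g' x\<bar> * f (g x)) = r"
    using has_absolute_integral_change_of_variables_1'[of UNIV g g' f r] g by auto
  then have "((\<lambda>x. \<bar>g' x\<bar> * f (g x)) has_integral r) UNIV"
    using set_lebesgue_integral_eq_integral(1) by (auto simp: has_integral_iff)
  then have "(\<integral>\<^sup>+x. ennreal (\<bar>g' x\<bar> * f (g x)) \<partial>lborel) = ennreal r"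
    by (intro nn_integral_has_integral_lborel) (use f(2) in auto)
  moreover have "0 \<le> r"
    using f by (auto intro: has_integral_nonneg)
  ultimately show ?thesis
    by (intro has_bochner_integral_nn_integral) (use f(2) in auto)
qed

lemma has_bochner_integral_lborel_shift:
  fixes f :: "real \<Rightarrow> real"
  assumes "has_bochner_integral lborel f r"
  shows "has_bochner_integral lborel (\<lambda>x. f (a + x)) r"
  using lborel_has_bochner_integral_real_affine_iff[of 1 f r a] assms by simp

lemma has_bochner_integral_lborel_reflect:
  fixes f :: "real \<Rightarrow> real"
  assumes "has_bochner_integral lborel f r"
  shows "has_bochner_integral lborel (\<lambda>x. f (a - x)) r"
  using lborel_has_bochner_integral_real_affine_iff[of "-1" f r a] assms by simp

lemma range_exp_real: "range (exp :: real \<Rightarrow> real) = {0<..}"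
proof -
  have "x \<in> range exp" if "0 < x" for x :: real
    using that by (metis exp_ln rangeI)
  then show ?thesis by auto
qed

text \<open>The Mellin integral of e^(-a x) in the variable t = log x: the substitution x = e^t for
  a = 1, then a shift by \<open>ln a\<close> that produces the factor a^s.\<close>

lemma has_bochner_integral_Gamma_exp:
  assumes "0 < (s::real)" "0 < a"
  shows "has_bochner_integral lborel (\<lambda>t. exp (- a * exp t) * exp (s * t)) (Gamma s / a powr s)"
proof -
  have "has_bochner_integral lborel (\<lambda>t::real. \<bar>exp t\<bar> * (exp t powr (s - 1) / exp (exp t))) (Gamma s)"
  proof (rule has_bochner_integral_substitution_nonneg[where f="\<lambda>t. t powr (s - 1) / exp t" and g=exp and g'=exp])
    have "((\<lambda>t. t powr (s - 1) / exp t) has_integral Gamma s) {0..}"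
      by (rule Gamma_integral_real) fact
    \<comment> \<open>The point 0 is discarded because the range of \<open>exp\<close> is the open
      half line.\<close>
    then have "((\<lambda>t. if t \<in> {0<..} then t powr (s - 1) / exp t else 0) has_integral Gamma s) {0..}"
      by (rule has_integral_spike[of "{0}", rotated 2]) auto
    then show "((\<lambda>t. t powr (s - 1) / exp t) has_integral Gamma s) (range exp)"
      by (subst (asm) has_integral_restrict) (auto simp: range_exp_real)
  qed (auto intro!: derivative_eq_intros simp: inj_def)
  also have "(\<lambda>t. \<bar>exp t\<bar> * (exp t powr (s - 1) / exp (exp t))) = (\<lambda>t. exp (- exp t) * exp (s * t))"
    by (auto simp: powr_def exp_minus field_simps simp flip: exp_add)
  finally have "has_bochner_integral lborel (\<lambda>t. exp (- exp (ln a + t)) * exp (s * (ln a + t))) (Gamma s)"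
    by (rule has_bochner_integral_lborel_shift)
  then have "has_bochner_integral lborel (\<lambda>t. exp (- exp (ln a + t)) * exp (s * (ln a + t)) / a powr s)
     (Gamma s / a powr s)"
    by (rule has_bochner_integral_divide_zero)
  also have "(\<lambda>t. exp (- exp (ln a + t)) * exp (s * (ln a + t)) / a powr s)
     = (\<lambda>t. exp (- a * exp t) * exp (s * t))"
    using assms by (auto simp: powr_def exp_add ring_distribs)
  finally show ?thesis .
qed

lemma has_bochner_integral_gaussian:
  assumes "0 < (c::real)"
  shows "has_bochner_integral lborel (\<lambda>x. exp (- c * x\<^sup>2)) (sqrt (pi / c))"
proof -
  define \<sigma> where "\<sigma> = 1 / sqrt (2 * c)"
  have \<sigma>: "\<sigma> > 0" "2 * \<sigma>\<^sup>2 = 1 / c" using assms by (auto simp: \<sigma>_def power_divide field_simps)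
  have "has_bochner_integral lborel (\<lambda>x. sqrt (pi / c) * normal_density 0 \<sigma> x) (sqrt (pi / c) * 1)"
    using \<sigma> by (intro has_bochner_integral_mult_right)
      (simp add: has_bochner_integral_iff)
  also have "(\<lambda>x. sqrt (pi / c) * normal_density 0 \<sigma> x) = (\<lambda>x. exp (- c * x\<^sup>2))"
  proof
    fix x
    have "2 * pi * \<sigma>\<^sup>2 = pi * (2 * \<sigma>\<^sup>2)" by simp
    then have "2 * pi * \<sigma>\<^sup>2 = pi / c" unfolding \<sigma>(2) by simp
    moreover have "x\<^sup>2 / (2 * \<sigma>\<^sup>2) = c * x\<^sup>2" unfolding \<sigma>(2) by simp
    ultimately show "sqrt (pi / c) * normal_density 0 \<sigma> x = exp (- c * x\<^sup>2)"
      using assms by (simp add: normal_density_def)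
  qed
  finally show ?thesis by simp
qed

lemma range_sinh_half: "range (\<lambda>t::real. sinh (t / 2)) = UNIV"
proof -
  have "x = sinh ((2 * arsinh x) / 2)" for x :: real by simp
  then show ?thesis by blast
qed

text \<open>This is 2 K_(1/2)(2c). The substitution x = sinh (t/2) makes the integral Gaussian,
  because cosh t = 1 + 2 sinh(t/2)^2 and cosh (t/2) / 2 is the Jacobian.\<close>

lemma has_bochner_integral_exp_cosh_half:
  assumes "0 < (c::real)"
  shows "has_bochner_integral lborel (\<lambda>t. exp (- 2 * c * cosh t) * cosh (t / 2)) (sqrt (pi / c) * exp (- 2 * c))"
proof -
  have "has_bochner_integral lborel (\<lambda>t. \<bar>cosh (t / 2) / 2\<bar> * exp (- (4 * c) * (sinh (t / 2))\<^sup>2)) (sqrt (pi / (4 * c)))"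
  proof (rule has_bochner_integral_substitution_nonneg[where f="\<lambda>x. exp (- (4 * c) * x\<^sup>2)"
        and g="\<lambda>t. sinh (t / 2)" and g'="\<lambda>t. cosh (t / 2) / 2"])
    have "((\<lambda>x. exp (- (4 * c) * x\<^sup>2)) has_integral sqrt (pi / (4 * c))) UNIV"
      using has_bochner_integral_gaussian[of "4 * c"] assms
        has_integral_integral_lborel[of "\<lambda>x. exp (- (4 * c) * x\<^sup>2)"]
      by (simp add: has_bochner_integral_iff)
    then show "((\<lambda>x. exp (- (4 * c) * x\<^sup>2)) has_integral sqrt (pi / (4 * c))) (range (\<lambda>t. sinh (t / 2)))"
      by (simp add: range_sinh_half)
    show "((\<lambda>t. sinh (t / 2)) has_real_derivative cosh (x / 2) / 2) (at x)" for x :: real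
      by (auto intro!: derivative_eq_intros)
    show "inj (\<lambda>t::real. sinh (t / 2))" by (auto simp: inj_def)
    show "(\<lambda>x::real. cosh (x / 2) / 2) \<in> borel_measurable borel"
      by (auto intro!: borel_measurable_continuous_onI continuous_intros)
  qed auto
  then have "has_bochner_integral lborel (\<lambda>t. 2 * exp (- 2 * c) * (\<bar>cosh (t / 2) / 2\<bar> * exp (- (4 * c) * (sinh (t / 2))\<^sup>2)))
     (2 * exp (- 2 * c) * sqrt (pi / (4 * c)))"
    by (intro has_bochner_integral_mult_right) auto
  also have "(\<lambda>t. 2 * exp (- 2 * c) * (\<bar>cosh (t / 2) / 2\<bar> * exp (- (4 * c) * (sinh (t / 2))\<^sup>2)))
     = (\<lambda>t. exp (- 2 * c * cosh t) * cosh (t / 2))"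
  proof
    fix t :: real
    have "cosh t = 1 + 2 * (sinh (t / 2))\<^sup>2"
      using cosh_double[of "t / 2"] cosh_square_eq[of "t / 2"] by simp
    then have "exp (- 2 * c * cosh t) = exp (- 2 * c) * exp (- (4 * c) * (sinh (t / 2))\<^sup>2)"
      by (simp add: algebra_simps flip: exp_add)
    then show "2 * exp (- 2 * c) * (\<bar>cosh (t / 2) / 2\<bar> * exp (- (4 * c) * (sinh (t / 2))\<^sup>2))
       = exp (- 2 * c * cosh t) * cosh (t / 2)"
      by (simp add: cosh_real_nonneg)
  qed
  also have "2 * exp (- 2 * c) * sqrt (pi / (4 * c)) = sqrt (pi / c) * exp (- 2 * c)"
    by (simp add: real_sqrt_divide real_sqrt_mult)
  finally show ?thesis .
qed

text \<open>Translation by half of \<open>ln (b / a)\<close> balances the two exponentials and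
  reduces integrals with two parameters to symmetric ones with the single parameter sqrt (a
  b).\<close>

lemma two_sqrt_cosh_shift:
  assumes "0 < a" "0 < b"
  shows "a * exp (ln (b / a) / 2 + t) + b * exp (- (ln (b / a) / 2 + t)) = 2 * sqrt (a * b) * cosh t"
proof -
  have e: "exp (ln (b / a) / 2) = sqrt (b / a)"
    using assms by (simp add: ln_sqrt[symmetric])
  have 1: "a * sqrt (b / a) = sqrt (a * b)"
    using assms by (simp add: real_sqrt_divide real_sqrt_mult field_simps)
  have 2: "b / sqrt (b / a) = sqrt (a * b)"
    using assms by (simp add: real_sqrt_divide real_sqrt_mult field_simps)
  have "a * exp (ln (b / a) / 2 + t) + b * exp (- (ln (b / a) / 2 + t))
    = a * sqrt (b / a) * exp t + b / sqrt (b / a) * exp (- t)"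
    unfolding minus_add_distrib exp_add exp_minus e by (simp add: field_simps)
  also have "\<dots> = 2 * sqrt (a * b) * cosh t"
    unfolding 1 2 by (simp add: cosh_def field_simps)
  finally show ?thesis .
qed

lemma has_bochner_integral_bessel_half:
  assumes "0 < a" "0 < b"
  shows "has_bochner_integral lborel (\<lambda>t. exp (- a * exp t - b * exp (- t)) * exp (t / 2))
           (sqrt (pi / a) * exp (- 2 * sqrt (a * b)))"
proof -
  define c where "c = sqrt (a * b)"
  define m where "m = ln (b / a) / 2"
  have c: "c > 0" using assms by (simp add: c_def)
  define F where "F = (\<lambda>t. exp (- 2 * c * cosh t) * exp (t / 2))"
  let ?I = "sqrt (pi / c) * exp (- 2 * c)"
  have "integrable lborel F"
  proof (rule Bochner_Integration.integrable_bound)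
    show "integrable lborel (\<lambda>t. 2 * (exp (- 2 * c * cosh t) * cosh (t / 2)))"
      using has_bochner_integral_exp_cosh_half[OF c] by (auto simp: has_bochner_integral_iff)
    have "F \<in> borel_measurable borel"
      unfolding F_def by (auto intro!: borel_measurable_continuous_onI continuous_intros)
    then show "F \<in> borel_measurable lborel" by simp
    have "exp (t / 2) \<le> 2 * cosh (t / 2)" for t :: real by (simp add: cosh_def)
    then have "F t \<le> 2 * (exp (- 2 * c * cosh t) * cosh (t / 2))" for t
      using mult_left_mono[of "exp (t / 2)" "2 * cosh (t / 2)" "exp (- 2 * c * cosh t)"]
      by (simp add: F_def)
    moreover have "F t \<ge> 0" for t by (simp add: F_def)
    ultimately show "AE x in lborel. norm (F x) \<le> norm (2 * (exp (- 2 * c * cosh x) * cosh (x / 2)))"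
      by (intro AE_I2) (metis abs_ge_self abs_of_nonneg order_trans real_norm_def)
  qed
  then have F: "has_bochner_integral lborel F (integral\<^sup>L lborel F)"
    by (simp add: has_bochner_integral_iff)
  \<comment> \<open>Averaging with the reflection replaces e^(t/2) by cosh (t/2), so the integral of
    \<open>F\<close> is the value already computed.\<close>
  have "has_bochner_integral lborel (\<lambda>t. (F t + F (0 - t)) / 2) ((integral\<^sup>L lborel F + integral\<^sup>L lborel F) / 2)"
    by (intro has_bochner_integral_divide_zero has_bochner_integral_add has_bochner_integral_lborel_reflect F)
  also have "(\<lambda>t. (F t + F (0 - t)) / 2) = (\<lambda>t. exp (- 2 * c * cosh t) * cosh (t / 2))"
    by (auto simp: F_def cosh_def field_simps)
  finally have "has_bochner_integral lborel (\<lambda>t. exp (- 2 * c * cosh t) * cosh (t / 2)) (integral\<^sup>L lborel F)"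
    by simp
  then have "integral\<^sup>L lborel F = ?I"
    using has_bochner_integral_exp_cosh_half[OF c] has_bochner_integral_eq by blast
  \<comment> \<open>The factor exp (m/2) compensates the e^(-m/2) that the shift by - m creates in
    e^(t/2).\<close>
  with F have "has_bochner_integral lborel (\<lambda>t. exp (m / 2) * F (- m + t)) (exp (m / 2) * ?I)"
    by (intro has_bochner_integral_mult_right has_bochner_integral_lborel_shift) auto
  also have "(\<lambda>t. exp (m / 2) * F (- m + t)) = (\<lambda>t. exp (- a * exp t - b * exp (- t)) * exp (t / 2))"
  proof
    fix t
    have "2 * c * cosh (- m + t) = a * exp t + b * exp (- t)"
      using two_sqrt_cosh_shift[OF assms, of "- m + t"] by (simp add: c_def m_def)
    then show "exp (m / 2) * F (- m + t) = exp (- a * exp t - b * exp (- t)) * exp (t / 2)"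
      by (simp add: F_def add_divide_distrib diff_divide_distrib flip: exp_add)
  qed
  also have "exp (m / 2) * ?I = sqrt (pi / a) * exp (- 2 * sqrt (a * b))"
  proof -
    have "exp (m / 2) = sqrt (sqrt (b / a))"
      using assms by (simp add: m_def ln_sqrt[symmetric] flip: ln_sqrt)
    then have "exp (m / 2) * sqrt (pi / c) = sqrt (sqrt (b / a) * (pi / sqrt (a * b)))"
      by (simp only: c_def real_sqrt_mult[symmetric])
    also have "sqrt (b / a) * (pi / sqrt (a * b)) = pi / a"
      using assms by (simp add: real_sqrt_divide real_sqrt_mult field_simps)
    finally show ?thesis by (simp add: c_def)
  qed
  finally show ?thesis .
qed

lemma has_bochner_integral_besselK0:
  assumes "0 < a" "0 < b"
  shows "has_bochner_integral lborel (\<lambda>t. exp (- a * exp t - b * exp (- t))) (2 * besselK0 (2 * sqrt (a * b)))"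
proof -
  define c where "c = sqrt (a * b)"
  define m where "m = ln (b / a) / 2"
  have c: "c > 0" using assms by (simp add: c_def)
  define F where "F = (\<lambda>t. exp (- (2 * c) * cosh t))"
  have meas: "F \<in> borel_measurable borel"
    unfolding F_def by (auto intro!: borel_measurable_continuous_onI continuous_intros)
  \<comment> \<open>Since cosh (t/2) \<ge> 1, the integrand of order 1/2 dominates the one of order
    0.\<close>
  have int: "integrable lborel F"
  proof (rule Bochner_Integration.integrable_bound)
    show "integrable lborel (\<lambda>t. exp (- 2 * c * cosh t) * cosh (t / 2))"
      using has_bochner_integral_exp_cosh_half[OF c] by (auto simp: has_bochner_integral_iff)
    show "F \<in> borel_measurable lborel" using meas by simp
    show "AE x in lborel. norm (F x) \<le> norm (exp (- 2 * c * cosh x) * cosh (x / 2))"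
      by (intro AE_I2) (simp add: F_def cosh_real_ge_1 abs_mult)
  qed
  have even: "has_bochner_integral lborel (\<lambda>x. indicator {0..} x *\<^sub>R F x) (besselK0 (2 * c))"
  proof -
    \<comment> \<open>\<open>besselK0\<close> is a gauge integral; absolute integrability identifies
      it with the Lebesgue integral and excludes the default value.\<close>
    have "set_integrable lborel {0..} F"
      unfolding set_integrable_def using int by (intro integrable_mult_indicator) auto
    moreover then have "set_lebesgue_integral lborel {0..} F = besselK0 (2 * c)"
      by (simp add: set_borel_integral_eq_integral besselK0_def F_def)
    ultimately show ?thesis
      by (simp add: has_bochner_integral_iff set_integrable_def set_lebesgue_integral_def)
  qed
  have "has_bochner_integral lborel F (2 *\<^sub>R besselK0 (2 * c))"
    by (rule has_bochner_integral_even_function[OF even]) (simp add: F_def)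
  then have "has_bochner_integral lborel (\<lambda>t. F (- m + t)) (2 * besselK0 (2 * c))"
    by (intro has_bochner_integral_lborel_shift) simp
  also have "(\<lambda>t. F (- m + t)) = (\<lambda>t. exp (- a * exp t - b * exp (- t)))"
  proof
    fix t
    have "2 * c * cosh (- m + t) = a * exp t + b * exp (- t)"
      using two_sqrt_cosh_shift[OF assms, of "- m + t"] by (simp add: c_def m_def)
    then show "F (- m + t) = exp (- a * exp t - b * exp (- t))"
      by (simp add: F_def)
  qed
  finally show ?thesis by (simp add: c_def)
qed

section \<open>The theta function\<close>

text \<open>The logarithmic derivative of Euler's reflection formula at the point iy expresses
  Digamma (1 - z) - Digamma z through pi cot (pi z), and the series of Digamma supplies the partial
  fractions. On the imaginary axis cot becomes coth.\<close>

lemma sums_coth: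
  fixes y :: real
  assumes "0 < y"
  shows "(\<lambda>n. 2 * y / ((real (Suc n))\<^sup>2 + y\<^sup>2)) sums (pi * cosh (pi * y) / sinh (pi * y) - 1 / y)"
proof -
  define z where "z = \<i> * complex_of_real y"
  define f where "f = (\<lambda>w::complex. Gamma w * Gamma (1 - w) * sin (of_real pi * w))"
  have notint: "w \<notin> \<int>" if "Im w > 0" for w using that by (auto elim!: Ints_cases)
  have Imz: "Im z = y" "Re z = 0" by (simp_all add: z_def)
  have z0: "z \<noteq> 0" using Imz assms by auto
  have nz: "z \<notin> \<int>" "z + 1 \<notin> \<int>" using Imz assms by (auto intro!: notint)
  have nz': "1 - z \<notin> \<int>"
  proof
    assume "1 - z \<in> \<int>"
    then have "1 - (1 - z) \<in> \<int>" by (intro Ints_diff) auto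
    with nz show False by simp
  qed
  have const: "f w = of_real pi" if "Im w > 0" for w
  proof -
    have "sin (of_real pi * w) \<noteq> 0"
    proof
      assume "sin (of_real pi * w) = 0"
      then obtain n :: int where "of_real pi * w = of_real (of_int n * pi)" by (auto simp: sin_eq_0)
      then have "Im (of_real pi * w) = 0" by simp
      with that show False by simp
    qed
    then show ?thesis
      using Gamma_reflection_complex[of w] by (simp add: f_def)
  qed
  \<comment> \<open>Near \<open>z\<close> the function \<open>f\<close> is the constant pi, so its
    derivative is 0; the product rule computes the same derivative in terms of Digamma.\<close>
  have D1: "(f has_field_derivative 0) (at z)"
  proof (rule has_field_derivative_transform_within_open)
    show "((\<lambda>_. of_real pi) has_field_derivative (0::complex)) (at z)" by simp
    show "open {w. Im w > 0}" by (rule open_halfspace_Im_gt)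
  qed (use Imz assms const in auto)
  have D2: "(f has_field_derivative (Gamma z * Gamma (1 - z) *
       ((Digamma z - Digamma (1 - z)) * sin (of_real pi * z) + of_real pi * cos (of_real pi * z)))) (at z)"
    unfolding f_def using nz nz'
    by (auto intro!: derivative_eq_intros simp: algebra_simps dest: nonpos_Ints_Int)
  have "Gamma z * Gamma (1 - z) *
       ((Digamma z - Digamma (1 - z)) * sin (of_real pi * z) + of_real pi * cos (of_real pi * z)) = 0"
    using DERIV_unique[OF D2 D1] .
  moreover have "Gamma z \<noteq> 0" "Gamma (1 - z) \<noteq> 0"
    using nz nz' by (auto simp: Gamma_eq_zero_iff dest: nonpos_Ints_Int)
  ultimately have "(Digamma z - Digamma (1 - z)) * sin (of_real pi * z) + of_real pi * cos (of_real pi * z) = 0"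
    by (simp only: mult_eq_0_iff) simp
  then have main: "(Digamma (1 - z) - Digamma z) * sin (of_real pi * z) = of_real pi * cos (of_real pi * z)"
    by (simp add: algebra_simps)
  \<comment> \<open>Digamma is taken at z + 1 instead of z so that the n-th terms pair up as
    1/(n+1+z) - 1/(n+1-z). \<open>Digamma_plus1\<close> later restores z and leaves the term -
    1/y.\<close>
  have "1 - z \<noteq> 0" "z + 1 \<noteq> 0" using nz(2) nz' Ints_0 by metis+
  then have "(\<lambda>n. (inverse (of_nat (Suc n)) - inverse (1 - z + of_nat n)) -
        (inverse (of_nat (Suc n)) - inverse (z + 1 + of_nat n))) sums
      ((Digamma (1 - z) + euler_mascheroni) - (Digamma (z + 1) + euler_mascheroni))"
    unfolding Digamma_def by (intro sums_diff) (simp_all only: diff_add_cancel summable_sums summable_Digamma not_False_eq_True)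
  moreover have "(inverse (of_nat (Suc n)) - inverse (1 - z + of_nat n)) -
        (inverse (of_nat (Suc n)) - inverse (z + 1 + of_nat n)) =
       - \<i> * of_real (2 * y / ((real (Suc n))\<^sup>2 + y\<^sup>2))" for n
  proof -
    have "(of_nat (Suc n) + z) * (of_nat (Suc n) - z) = of_real ((real (Suc n))\<^sup>2 + y\<^sup>2)"
      by (simp add: z_def algebra_simps power2_eq_square)
    moreover have "(real (Suc n))\<^sup>2 + y\<^sup>2 \<noteq> 0" by (metis assms sum_power2_eq_zero_iff less_irrefl)
    ultimately have ne: "of_nat (Suc n) + z \<noteq> 0" "of_nat (Suc n) - z \<noteq> 0"
      and e: "1 / of_real ((real (Suc n))\<^sup>2 + y\<^sup>2) = 1 / ((of_nat (Suc n) + z) * (of_nat (Suc n) - z))"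
      by (metis mult_eq_0_iff of_real_eq_0_iff)+
    have "(inverse (of_nat (Suc n)) - inverse (1 - z + of_nat n)) -
        (inverse (of_nat (Suc n)) - inverse (z + 1 + of_nat n))
       = 1 / (of_nat (Suc n) + z) - 1 / (of_nat (Suc n) - z)"
      by (simp add: inverse_eq_divide algebra_simps)
    also have "\<dots> = - (2 * z) * (1 / ((of_nat (Suc n) + z) * (of_nat (Suc n) - z)))"
      using ne by (simp add: divide_simps)
    also have "\<dots> = - \<i> * of_real (2 * y / ((real (Suc n))\<^sup>2 + y\<^sup>2))"
      unfolding e[symmetric] by (simp add: z_def)
    finally show ?thesis .
  qed
  ultimately have S: "(\<lambda>n. - \<i> * of_real (2 * y / ((real (Suc n))\<^sup>2 + y\<^sup>2))) sums
     (Digamma (1 - z) - Digamma (z + 1))"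
    by simp
  from sums_Im[OF this] have "(\<lambda>n. 2 * y / ((real (Suc n))\<^sup>2 + y\<^sup>2)) sums - Im (Digamma (1 - z) - Digamma (z + 1))"
    using sums_minus by fastforce
  moreover have "- Im (Digamma (1 - z) - Digamma (z + 1)) = pi * cosh (pi * y) / sinh (pi * y) - 1 / y"
  proof -
    have sn: "sin (of_real pi * z) = \<i> * of_real (sinh (pi * y))"
    proof -
      have "sinh (of_real x :: complex) = of_real (sinh x)" for x :: real
        by (simp add: sinh_field_def exp_of_real flip: of_real_minus)
      then have "of_real (sinh (pi * y)) = - \<i> * sin (\<i> * of_real (pi * y))"
        by (metis sinh_conv_sin)
      moreover have "of_real pi * z = \<i> * of_real (pi * y)" by (simp add: z_def)
      ultimately show ?thesis by (simp add: mult_ac)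
    qed
    have cs: "cos (of_real pi * z) = of_real (cosh (pi * y))"
    proof -
      have "cosh (of_real x :: complex) = of_real (cosh x)" for x :: real
        by (simp add: cosh_field_def exp_of_real flip: of_real_minus)
      then have "of_real (cosh (pi * y)) = cos (\<i> * of_real (pi * y))"
        by (metis cosh_conv_cos)
      moreover have "of_real pi * z = \<i> * of_real (pi * y)" by (simp add: z_def)
      ultimately show ?thesis by (simp add: mult_ac)
    qed
    have "sinh (pi * y) \<noteq> 0" using assms by simp
    then have "Digamma (1 - z) - Digamma z = of_real pi * of_real (cosh (pi * y)) / (\<i> * of_real (sinh (pi * y)))"
      using main unfolding sn cs by (simp add: field_simps)
    also have "\<dots> = - \<i> * of_real (pi * cosh (pi * y) / sinh (pi * y))"
      by (simp add: divide_inverse mult_ac)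
    finally have "Digamma (1 - z) - Digamma (z + 1) = - \<i> * of_real (pi * cosh (pi * y) / sinh (pi * y)) - 1 / z"
      using Digamma_plus1[OF z0] by (simp add: algebra_simps)
    also have "1 / z = - \<i> * of_real (1 / y)"
      using assms by (simp add: z_def field_simps)
    finally show ?thesis by simp
  qed
  ultimately show ?thesis by simp
qed

section \<open>The Jacobi theta series: convergence, bounds, continuity\<close>

definition theta :: "real \<Rightarrow> real" where
  "theta x = 1 + 2 * (\<Sum>n. exp (- pi * x * (real (Suc n))\<^sup>2))"

lemma theta_term_le: "0 < x \<Longrightarrow> exp (- pi * x * (real (Suc n))\<^sup>2) \<le> exp (- pi * x) ^ Suc n"
proof -
  assume x: "0 < x"
  have "real (Suc n) \<le> (real (Suc n))\<^sup>2" by (intro self_le_power) auto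
  then have "pi * x * real (Suc n) \<le> pi * x * (real (Suc n))\<^sup>2" using x by (intro mult_left_mono) auto
  moreover have "exp (- pi * x) ^ Suc n = exp (- (pi * x * real (Suc n)))"
    by (subst exp_of_nat_mult[symmetric]) (simp add: mult.commute)
  ultimately show ?thesis by simp
qed

lemma summable_theta: "0 < x \<Longrightarrow> summable (\<lambda>n. exp (- pi * x * (real (Suc n))\<^sup>2))"
  by (rule summable_comparison_test[OF _ summable_mult[OF summable_geometric, of "exp (- pi * x)" "exp (- pi * x)"]])
     (use theta_term_le in auto)

lemma theta_ge_1: "0 < x \<Longrightarrow> 1 \<le> theta x"
  unfolding theta_def using suminf_nonneg[OF summable_theta] by auto

lemma theta_le: "0 < x \<Longrightarrow> theta x - 1 \<le> 2 * exp (- pi * x) / (1 - exp (- pi * x))"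
proof -
  assume x: "0 < x"
  have r: "(\<lambda>n. exp (- pi * x) * exp (- pi * x) ^ n) sums (exp (- pi * x) * (1 / (1 - exp (- pi * x))))"
    by (intro sums_mult geometric_sums) (use x in auto)
  have "(\<Sum>n. exp (- pi * x * (real (Suc n))\<^sup>2)) \<le> (\<Sum>n. exp (- pi * x) * exp (- pi * x) ^ n)"
    by (rule suminf_le) (use x summable_theta sums_summable[OF r] theta_term_le in auto)
  also have "\<dots> = exp (- pi * x) * (1 / (1 - exp (- pi * x)))" using r by (rule sums_unique[symmetric])
  finally show ?thesis by (simp add: theta_def)
qed

lemma has_sum_nat_ge_1:
  fixes f :: "nat \<Rightarrow> real"
  assumes "(\<lambda>n. f (Suc n)) sums S" "\<And>n. 1 \<le> n \<Longrightarrow> 0 \<le> f n"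
  shows "(f has_sum S) {1..}"
proof -
  have "((\<lambda>n. f (Suc n)) has_sum S) UNIV"
    using assms by (intro sums_nonneg_imp_has_sum) auto
  then have "(f has_sum S) (range Suc)"
    by (subst has_sum_reindex) (auto simp: o_def)
  moreover have "range Suc = {1..}" by (auto simp: image_iff Suc_le_eq dest: gr0_implies_Suc)
  ultimately show ?thesis by simp
qed

lemma has_sum_theta_nat:
  assumes "0 < x"
  shows "((\<lambda>n::nat. 2 * exp (- pi * x * (real n)\<^sup>2)) has_sum (theta x - 1)) {1..}"
proof (rule has_sum_nat_ge_1)
  show "(\<lambda>n. 2 * exp (- pi * x * (real (Suc n))\<^sup>2)) sums (theta x - 1)"
    unfolding theta_def using summable_theta[OF assms] by (auto intro!: sums_mult summable_sums)
qed auto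

lemma has_sum_theta:
  assumes "0 < x"
  shows "((\<lambda>n::int. exp (- pi * x * (real_of_int n)\<^sup>2)) has_sum theta x) UNIV"
proof -
  have "((\<lambda>n::nat. exp (- pi * x * (real_of_int (int n))\<^sup>2)) has_sum ((theta x - 1) / 2)) {1..}"
    using has_sum_cmult_right[OF has_sum_theta_nat[OF assms], of "1 / 2"] by simp
  from has_sum_even_int[OF this] have "((\<lambda>n::int. exp (- pi * x * (real_of_int n)\<^sup>2)) has_sum
      (1 + 2 * ((theta x - 1) / 2))) UNIV" by simp
  also have "1 + 2 * ((theta x - 1) / 2) = theta x" by (simp add: field_simps)
  finally show ?thesis .
qed

lemma continuous_on_theta: "continuous_on {0<..} theta"
proof (rule continuous_at_imp_continuous_on, rule ballI)
  fix x :: real assume "x \<in> {0<..}"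
  then have x: "x > 0" by simp
  define d where "d = x / 2"
  have d: "0 < d" "d < x" using x by (auto simp: d_def)
  have "uniform_limit {d<..} (\<lambda>n x. \<Sum>i<n. exp (- pi * x * (real (Suc i))\<^sup>2))
      (\<lambda>x. \<Sum>n. exp (- pi * x * (real (Suc n))\<^sup>2)) sequentially"
  proof (rule Weierstrass_m_test[OF _ summable_theta[OF d(1)]])
    fix n and y :: real assume "y \<in> {d<..}"
    then have "pi * d * (real (Suc n))\<^sup>2 \<le> pi * y * (real (Suc n))\<^sup>2"
      by (intro mult_right_mono mult_left_mono) auto
    then show "norm (exp (- pi * y * (real (Suc n))\<^sup>2)) \<le> exp (- pi * d * (real (Suc n))\<^sup>2)" by simp
  qed
  then have "continuous_on {d<..} (\<lambda>x. \<Sum>n. exp (- pi * x * (real (Suc n))\<^sup>2))"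
    by (rule uniform_limit_theorem[rotated]) (auto intro!: always_eventually continuous_intros)
  then have "continuous_on {d<..} theta"
    unfolding theta_def[abs_def] by (intro continuous_intros)
  then show "isCont theta x"
    using d by (auto simp: continuous_on_eq_continuous_at)
qed

lemma continuous_on_theta_exp: "continuous_on UNIV (\<lambda>t. theta (exp (c * t)))"
  by (rule continuous_on_compose2[OF continuous_on_theta]) (auto intro!: continuous_intros)

section \<open>Uniqueness of Laplace transforms\<close>

lemma continuous_on_moment_uniqueness:
  fixes k Y :: "real \<Rightarrow> real"
  assumes k: "integrable lborel k" and Y: "\<And>t. 0 \<le> Y t" "\<And>t. Y t \<le> 1" "continuous_on UNIV Y"
    and mom: "\<And>n. (\<integral>t. Y t ^ n * k t \<partial>lborel) = 0"
    and phi: "continuous_on {0..1} \<phi>"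
  shows "integrable lborel (\<lambda>t. \<phi> (Y t) * k t)" "(\<integral>t. \<phi> (Y t) * k t \<partial>lborel) = 0"
proof -
  have bounded_int: "integrable lborel (\<lambda>t. \<psi> (Y t) * k t)"
    and bounded_le: "(\<And>y. y \<in> {0..1} \<Longrightarrow> \<bar>\<psi> y\<bar> \<le> B) \<Longrightarrow>
        \<bar>\<integral>t. \<psi> (Y t) * k t \<partial>lborel\<bar> \<le> B * (\<integral>t. \<bar>k t\<bar> \<partial>lborel)"
    if psi: "continuous_on {0..1} \<psi>" for \<psi> B
  proof -
    have "continuous_on UNIV (\<lambda>t. \<psi> (Y t))"
      by (rule continuous_on_compose2[OF psi Y(3)]) (use Y in auto)
    then have meas: "(\<lambda>t. \<psi> (Y t)) \<in> borel_measurable lborel"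
      using borel_measurable_continuous_onI by fastforce
    have int: "integrable lborel (\<lambda>t. \<psi> (Y t) * k t)"
      if "\<And>y. y \<in> {0..1} \<Longrightarrow> \<bar>\<psi> y\<bar> \<le> B" for B
    proof (rule Bochner_Integration.integrable_bound)
      show "integrable lborel (\<lambda>t. B * k t)" using k by simp
      show "(\<lambda>t. \<psi> (Y t) * k t) \<in> borel_measurable lborel" using meas k by measurable
      show "AE t in lborel. norm (\<psi> (Y t) * k t) \<le> norm (B * k t)"
      proof (rule AE_I2)
        fix t
        have "\<bar>\<psi> (Y t)\<bar> \<le> \<bar>B\<bar>" using that[of "Y t"] Y by fastforce
        then show "norm (\<psi> (Y t) * k t) \<le> norm (B * k t)"
          by (simp add: abs_mult mult_right_mono)
      qed
    qed
    have "bounded (\<psi> ` {0..1})" using psi by (intro compact_imp_bounded compact_continuous_image) auto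
    then obtain C where "\<forall>z\<in>\<psi> ` {0..1}. norm z \<le> C" unfolding bounded_iff by blast
    then have "\<bar>\<psi> y\<bar> \<le> C" if "y \<in> {0..1}" for y using that by force
    from int[OF this] show i: "integrable lborel (\<lambda>t. \<psi> (Y t) * k t)" by simp
    assume B: "\<And>y. y \<in> {0..1} \<Longrightarrow> \<bar>\<psi> y\<bar> \<le> B"
    have "\<bar>\<integral>t. \<psi> (Y t) * k t \<partial>lborel\<bar> \<le> (\<integral>t. \<bar>\<psi> (Y t) * k t\<bar> \<partial>lborel)"
      by (rule integral_abs_bound)
    also have "\<dots> \<le> (\<integral>t. B * \<bar>k t\<bar> \<partial>lborel)"
      using integrable_abs[OF i] k B Y by (intro integral_mono) (auto simp: abs_mult intro!: mult_right_mono)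
    finally show "\<bar>\<integral>t. \<psi> (Y t) * k t \<partial>lborel\<bar> \<le> B * (\<integral>t. \<bar>k t\<bar> \<partial>lborel)" by simp
  qed
  show "integrable lborel (\<lambda>t. \<phi> (Y t) * k t)" by (rule bounded_int[OF phi])
  \<comment> \<open>Vanishing moments kill every polynomial in \<open>Y\<close>; Stone-Weierstrass
    carries this over to \<open>\<phi>\<close>, the error being controlled by the L^1 norm
    \<open>K\<close> of \<open>k\<close>.\<close>
  have poly: "(\<integral>t. g (Y t) * k t \<partial>lborel) = 0" if pg: "real_polynomial_function g" for g
  proof -
    obtain a n where g: "g = (\<lambda>x. \<Sum>i\<le>n. a i * x ^ i)"
      using real_polynomial_function_imp_sum[OF pg] by auto
    have pw: "integrable lborel (\<lambda>t. Y t ^ i * k t)" for i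
      by (rule bounded_int) (intro continuous_intros)
    have "(\<integral>t. g (Y t) * k t \<partial>lborel) = (\<integral>t. (\<Sum>i\<le>n. a i * (Y t ^ i * k t)) \<partial>lborel)"
      by (simp add: g sum_distrib_right mult.assoc)
    also have "\<dots> = (\<Sum>i\<le>n. a i * (\<integral>t. Y t ^ i * k t \<partial>lborel))"
      using pw by (subst Bochner_Integration.integral_sum) auto
    finally show ?thesis by (simp add: mom)
  qed
  define K where "K = (\<integral>t. \<bar>k t\<bar> \<partial>lborel)"
  have K: "K \<ge> 0" by (simp add: K_def)
  have "\<bar>\<integral>t. \<phi> (Y t) * k t \<partial>lborel\<bar> \<le> 0 + e" if "e > 0" for e
  proof -
    \<comment> \<open>The summand 1 covers the case K = 0.\<close>
    define e' where "e' = e / (K + 1)"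
    have e': "e' > 0" using that K by (simp add: e'_def)
    obtain g where g: "real_polynomial_function g" "\<And>x. x \<in> {0..1} \<Longrightarrow> \<bar>\<phi> x - g x\<bar> < e'"
      using Stone_Weierstrass_real_polynomial_function[OF compact_Icc phi e'] by blast
    have cg: "continuous_on {0..1} g"
      using g(1) by (simp add: continuous_on_polymonial_function real_polynomial_function_eq)
    have "(\<integral>t. (\<phi> (Y t) - g (Y t)) * k t \<partial>lborel) = (\<integral>t. \<phi> (Y t) * k t \<partial>lborel) - (\<integral>t. g (Y t) * k t \<partial>lborel)"
      unfolding left_diff_distrib by (rule Bochner_Integration.integral_diff) (auto intro: bounded_int phi cg)
    then have "\<bar>\<integral>t. \<phi> (Y t) * k t \<partial>lborel\<bar> = \<bar>\<integral>t. (\<phi> (Y t) - g (Y t)) * k t \<partial>lborel\<bar>"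
      using poly[OF g(1)] by simp
    also have "\<dots> \<le> e' * K"
      unfolding K_def using g(2) by (intro bounded_le[of "\<lambda>y. \<phi> y - g y"] continuous_on_diff phi cg) force
    also have "\<dots> \<le> e" using that K by (simp add: e'_def field_simps)
    finally show ?thesis by simp
  qed
  then have "\<bar>\<integral>t. \<phi> (Y t) * k t \<partial>lborel\<bar> \<le> 0" by (rule field_le_epsilon)
  then show "(\<integral>t. \<phi> (Y t) * k t \<partial>lborel) = 0" by simp
qed

lemma integral_eq_0_continuous_nonneg:
  fixes f :: "real \<Rightarrow> real"
  assumes "continuous_on UNIV f" "integrable lborel f" "\<And>x. 0 \<le> f x" "(\<integral>x. f x \<partial>lborel) = 0"
  shows "f x = 0"
proof (rule ccontr)
  assume "f x \<noteq> 0"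
  have "AE x in lborel. f x = 0"
    using integral_nonneg_eq_0_iff_AE[OF assms(2)] assms by auto
  moreover have "open {x. f x \<noteq> 0}"
    using assms(1) by (intro open_Collect_neq) auto
  ultimately have "{x. f x \<noteq> 0} \<in> null_sets lborel"
    using AE_iff_null_sets[of "{x. f x \<noteq> 0}" lborel] by auto
  then have "negligible {x. f x \<noteq> 0}"
    using null_sets_completionI negligible_iff_null_sets by blast
  then show False
    using open_not_negligible[OF \<open>open {x. f x \<noteq> 0}\<close>] \<open>f x \<noteq> 0\<close> by blast
qed

text \<open>Lerch's argument: at s = n + 1 the hypothesis is the vanishing of the n-th moment of k =
  e^(-e^t) h in the variable Y = e^(-e^t). As Y is injective, k is a function of Y, so there is a
  test function of Y with the sign of k.\<close>

lemma laplace_exp_uniqueness: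
  fixes h :: "real \<Rightarrow> real"
  assumes h: "continuous_on UNIV h" "integrable lborel (\<lambda>t. exp (- exp t) * h t)"
    and lap: "\<And>s. 1 \<le> s \<Longrightarrow> (\<integral>t. exp (- s * exp t) * h t \<partial>lborel) = 0"
  shows "h t = 0"
proof -
  define Y where "Y = (\<lambda>t::real. exp (- exp t))"
  define k where "k = (\<lambda>t. exp (- exp t) * h t)"
  \<comment> \<open>On (0,1) the inverse of \<open>Y\<close> is ln (- ln y), hence
    \<open>H (Y t) = k t\<close>.\<close>
  define H where "H = (\<lambda>y. k (ln (- ln y)))"
  \<comment> \<open>The factor y (1 - y) makes the test function continuous at 0 and 1, and the rest makes
    its product with k a nonnegative multiple of k^2.\<close>
  define \<phi> where "\<phi> = (\<lambda>y::real. if y \<in> {0<..<1} then y * (1 - y) * (H y / (1 + (H y)\<^sup>2)) else 0)"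
  have Y01: "0 < Y t" "Y t < 1" for t by (auto simp: Y_def)
  have HY: "H (Y t) = k t" for t by (simp add: H_def Y_def)
  have contk: "continuous_on UNIV k" unfolding k_def using h(1) by (intro continuous_intros)
  have pos: "0 < 1 + a\<^sup>2" for a :: real by (simp add: add_pos_nonneg)
  have bnd: "\<bar>\<phi> y\<bar> \<le> \<bar>y * (1 - y)\<bar>" for y
  proof -
    have "\<bar>a / (1 + a\<^sup>2)\<bar> \<le> 1" for a :: real
    proof -
      have "\<bar>a\<bar> \<le> 1 + a\<^sup>2" using sum_squares_bound[of "\<bar>a\<bar>" 1] by (simp add: power2_eq_square)
      then show ?thesis using pos[of a] by (simp add: abs_divide)
    qed
    from mult_left_mono[OF this, of "\<bar>y * (1 - y)\<bar>"] show ?thesis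
      by (auto simp: \<phi>_def abs_mult)
  qed
  have "isCont \<phi> y" if y: "y \<in> {0..1}" for y
  proof (cases "y \<in> {0<..<1}")
    case True
    have "continuous_on {0<..<1::real} (\<lambda>y. ln (- ln y))"
      by (auto intro!: continuous_intros)
    then have "continuous_on {0<..<1} H"
      unfolding H_def by (rule continuous_on_compose2[OF contk]) auto
    then have "continuous_on {0<..<1} (\<lambda>y. y * (1 - y) * (H y / (1 + (H y)\<^sup>2)))"
      using pos by (intro continuous_intros) (auto simp: less_imp_neq[symmetric])
    then have "continuous_on {0<..<1} \<phi>"
      by (rule continuous_on_eq) (simp add: \<phi>_def)
    then show ?thesis using True by (simp add: continuous_on_eq_continuous_at)
  next
    case False
    then have y01: "y = 0 \<or> y = 1" using y by auto
    have "isCont (\<lambda>x. x * (1 - x)) y" by (intro continuous_intros)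
    then have "((\<lambda>x. x * (1 - x)) \<longlongrightarrow> 0) (at y)" using y01 by (auto simp: isCont_def)
    from tendsto_rabs_zero[OF this] have "(\<phi> \<longlongrightarrow> 0) (at y)"
      by (rule Lim_null_comparison[rotated]) (simp add: bnd)
    moreover have "\<phi> y = 0" using y01 by (auto simp: \<phi>_def)
    ultimately show ?thesis by (simp add: isCont_def)
  qed
  then have phi: "continuous_on {0..1} \<phi>"
    by (intro continuous_at_imp_continuous_on) auto
  have contY: "continuous_on UNIV Y" unfolding Y_def by (intro continuous_intros)
  have mom: "(\<integral>t. Y t ^ n * k t \<partial>lborel) = 0" for n
  proof -
    have "Y t ^ n * k t = exp (- real (Suc n) * exp t) * h t" for t
      by (simp add: Y_def k_def algebra_simps flip: exp_of_nat_mult exp_add)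
    then show ?thesis using lap[of "real (Suc n)"] by simp
  qed
  have "integrable lborel (\<lambda>t. \<phi> (Y t) * k t)" "(\<integral>t. \<phi> (Y t) * k t \<partial>lborel) = 0"
    using continuous_on_moment_uniqueness[OF _ _ _ contY mom phi] h(2) Y01
    by (auto simp: k_def less_imp_le)
  moreover have eq: "\<phi> (Y t) * k t = Y t * (1 - Y t) * ((k t)\<^sup>2 / (1 + (k t)\<^sup>2))" for t
    using Y01[of t] by (simp add: \<phi>_def HY power2_eq_square)
  moreover have "continuous_on UNIV (\<lambda>t. \<phi> (Y t) * k t)"
    by (intro continuous_intros contk continuous_on_compose2[OF phi contY])
       (use Y01 in \<open>auto simp: less_imp_le\<close>)
  moreover have "0 \<le> \<phi> (Y t) * k t" for t
    unfolding eq using Y01[of t] by simp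
  ultimately have "\<phi> (Y t) * k t = 0"
    by (intro integral_eq_0_continuous_nonneg[of "\<lambda>t. \<phi> (Y t) * k t"]) auto
  then have "k t = 0" unfolding eq using Y01[of t] pos[of "k t"] by auto
  then show ?thesis by (simp add: k_def)
qed

text \<open>The Laplace transform of theta(x) dx, the factor e^t being the Jacobian of x = e^t. Each
  term integrates to 1 / (s + pi n^2).\<close>

lemma theta_laplace:
  assumes s: "0 < s"
  shows "has_bochner_integral lborel (\<lambda>t. exp (- s * exp t) * (exp t * theta (exp t)))
           (cosh (sqrt (pi * s)) / sinh (sqrt (pi * s)) * sqrt (pi / s))"
proof (subst has_bochner_integral_has_sum_iff[where I="UNIV::int set"
      and f="\<lambda>n t. exp (- (s + pi * (real_of_int n)\<^sup>2) * exp t) * exp (1 * t)"])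
  show "has_bochner_integral lborel (\<lambda>t. exp (- (s + pi * (real_of_int n)\<^sup>2) * exp t) * exp (1 * t))
     (Gamma 1 / (s + pi * (real_of_int n)\<^sup>2) powr 1)" for n
    by (rule has_bochner_integral_Gamma_exp) (use s in \<open>auto intro: add_pos_nonneg\<close>)
  show "((\<lambda>n::int. exp (- (s + pi * (real_of_int n)\<^sup>2) * exp t) * exp (1 * t)) has_sum
      exp (- s * exp t) * (exp t * theta (exp t))) UNIV" for t
    using has_sum_cmult_right[OF has_sum_theta[of "exp t"], of "exp (- s * exp t) * exp t"]
    by (simp add: ring_distribs exp_diff exp_minus field_simps)
  show "(\<lambda>t. exp (- s * exp t) * (exp t * theta (exp t))) \<in> borel_measurable lborel"
    using continuous_on_theta_exp[of 1]
    by (auto intro!: borel_measurable_continuous_onI continuous_intros)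
  \<comment> \<open>With this \<open>y\<close> the denominator s + pi n^2 is pi (n^2 + y^2), the
    shape found in \<open>sums_coth\<close>.\<close>
  define y where "y = sqrt (s / pi)"
  have y: "0 < y" "s = pi * y\<^sup>2" using s by (auto simp: y_def)
  have "((\<lambda>n::nat. 2 * y / ((real n)\<^sup>2 + y\<^sup>2)) has_sum (pi * cosh (pi * y) / sinh (pi * y) - 1 / y)) {1..}"
    by (rule has_sum_nat_ge_1) (use y sums_coth in auto)
  from has_sum_cmult_right[OF this, of "1 / (2 * pi * y)"]
  have "((\<lambda>n::nat. Gamma 1 / (s + pi * (real_of_int (int n))\<^sup>2) powr 1) has_sum
      (1 / (2 * pi * y)) * (pi * cosh (pi * y) / sinh (pi * y) - 1 / y)) {1..}"
  proof (rule has_sum_cong[THEN iffD1, rotated])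
    fix n :: nat
    have "0 < (real n)\<^sup>2 + y\<^sup>2" using y by (simp add: add_nonneg_pos)
    then show "1 / (2 * pi * y) * (2 * y / ((real n)\<^sup>2 + y\<^sup>2)) = Gamma 1 / (s + pi * (real_of_int (int n))\<^sup>2) powr 1"
      using y by (simp add: field_simps)
  qed
  from has_sum_even_int[where g="\<lambda>n. Gamma 1 / (s + pi * (real_of_int n)\<^sup>2) powr 1", OF this]
  have "((\<lambda>n::int. Gamma 1 / (s + pi * (real_of_int n)\<^sup>2) powr 1) has_sum
     (1 / s + 2 * ((1 / (2 * pi * y)) * (pi * cosh (pi * y) / sinh (pi * y) - 1 / y)))) UNIV"
    using s by simp
  also have "1 / s + 2 * ((1 / (2 * pi * y)) * (pi * cosh (pi * y) / sinh (pi * y) - 1 / y))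
     = cosh (pi * y) / sinh (pi * y) * (1 / y)"
  proof -
    have "sinh (pi * y) \<noteq> 0" using y by simp
    then show ?thesis using y(1) unfolding y(2) by (simp add: field_simps power2_eq_square)
  qed
  also have "pi * y = sqrt (pi * s)"
    using y by (simp add: real_sqrt_mult power2_eq_square)
  also have "1 / y = sqrt (pi / s)"
    using s by (simp add: y_def real_sqrt_divide)
  finally show "((\<lambda>n::int. Gamma 1 / (s + pi * (real_of_int n)\<^sup>2) powr 1) has_sum
    cosh (sqrt (pi * s)) / sinh (sqrt (pi * s)) * sqrt (pi / s)) UNIV" .
qed auto

text \<open>The Laplace transform of x^(-1/2) theta(1/x). The terms with n \<noteq> 0 are Bessel
  integrals of order 1/2, hence multiples of powers of q = e^(-2 sqrt (pi s)), and the geometric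
  series over Z sums to (1 + q)/(1 - q).\<close>

lemma theta_inverse_laplace:
  assumes s: "0 < s"
  shows "has_bochner_integral lborel (\<lambda>t. exp (- s * exp t) * (exp (t / 2) * theta (exp (- t))))
           (cosh (sqrt (pi * s)) / sinh (sqrt (pi * s)) * sqrt (pi / s))"
proof (subst has_bochner_integral_has_sum_iff[where I="UNIV::int set"
      and f="\<lambda>n t. exp (- s * exp t - (pi * (real_of_int n)\<^sup>2) * exp (- t)) * exp (t / 2)"])
  show "has_bochner_integral lborel (\<lambda>t. exp (- s * exp t - (pi * (real_of_int n)\<^sup>2) * exp (- t)) * exp (t / 2))
     (sqrt (pi / s) * exp (- 2 * sqrt (pi * s)) powr \<bar>real_of_int n\<bar>)" for n
  proof (cases "n = 0")
    \<comment> \<open>Here b = 0, which the Bessel integral excludes; the value is Gamma (1/2) /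
      sqrt s.\<close>
    case True
    then show ?thesis
      using has_bochner_integral_Gamma_exp[of "1/2" s] s
      by (simp add: Gamma_one_half_real powr_half_sqrt real_sqrt_divide)
  next
    case False
    have "sqrt (s * (pi * (real_of_int n)\<^sup>2)) = sqrt (pi * s) * \<bar>real_of_int n\<bar>"
      by (simp add: real_sqrt_mult)
    then show ?thesis
      using has_bochner_integral_bessel_half[of s "pi * (real_of_int n)\<^sup>2"] s False
      by (simp add: powr_def mult_ac)
  qed
  show "((\<lambda>n::int. exp (- s * exp t - (pi * (real_of_int n)\<^sup>2) * exp (- t)) * exp (t / 2)) has_sum
      exp (- s * exp t) * (exp (t / 2) * theta (exp (- t)))) UNIV" for t
  proof -
    have "exp (- s * exp t - (pi * (real_of_int n)\<^sup>2) * exp (- t)) * exp (t / 2)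
        = (exp (- s * exp t) * exp (t / 2)) * exp (- pi * exp (- t) * (real_of_int n)\<^sup>2)" for n
      by (simp add: algebra_simps flip: exp_add)
    then show ?thesis
      using has_sum_cmult_right[OF has_sum_theta[of "exp (- t)"], of "exp (- s * exp t) * exp (t / 2)"]
      by (simp add: mult_ac)
  qed
  show "(\<lambda>t. exp (- s * exp t) * (exp (t / 2) * theta (exp (- t)))) \<in> borel_measurable lborel"
    using continuous_on_theta_exp[of "-1"]
    by (auto intro!: borel_measurable_continuous_onI continuous_intros)
  define u where "u = sqrt (pi * s)"
  define q where "q = exp (- 2 * u)"
  have u: "0 < u" using s by (simp add: u_def)
  have q: "0 < q" "q < 1" using u by (auto simp: q_def)
  have "((\<lambda>n::nat. sqrt (pi / s) * q powr \<bar>real_of_int (int n)\<bar>) has_sum (sqrt (pi / s) * (q / (1 - q)))) {1..}"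
    using has_sum_cmult_right[OF has_sum_geometric_from_1[of q], of "sqrt (pi / s)"] q
    by (simp add: powr_realpow)
  from has_sum_even_int[where g="\<lambda>n. sqrt (pi / s) * q powr \<bar>real_of_int n\<bar>", OF this]
  have "((\<lambda>n::int. sqrt (pi / s) * q powr \<bar>real_of_int n\<bar>) has_sum
     (sqrt (pi / s) + 2 * (sqrt (pi / s) * (q / (1 - q))))) UNIV"
    using q by simp
  also have "sqrt (pi / s) + 2 * (sqrt (pi / s) * (q / (1 - q))) = (1 + q) / (1 - q) * sqrt (pi / s)"
    using q by (simp add: field_simps)
  also have "(1 + q) / (1 - q) = cosh u / sinh u"
  proof -
    have "q = exp (- u) * exp (- u)" by (simp add: q_def flip: exp_add)
    moreover have "exp (- u) * exp u = 1" by (simp flip: exp_add)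
    ultimately have "1 + q = exp (- u) * (2 * cosh u)" "1 - q = exp (- u) * (2 * sinh u)"
      by (simp_all add: cosh_def sinh_def algebra_simps)
    then show ?thesis by simp
  qed
  finally show "((\<lambda>n::int. sqrt (pi / s) * exp (- 2 * sqrt (pi * s)) powr \<bar>real_of_int n\<bar>) has_sum
    cosh (sqrt (pi * s)) / sinh (sqrt (pi * s)) * sqrt (pi / s)) UNIV" by (simp add: q_def u_def)
qed auto

text \<open>\<open>h\<close> is x (theta(x) - x^(-1/2) theta(1/x)) at x = e^t, so both Laplace
  transforms have the same kernel and uniqueness gives h = 0.\<close>

lemma theta_exp_minus: "theta (exp (- t)) = exp (t / 2) * theta (exp t)"
proof -
  define h where "h = (\<lambda>t. exp t * theta (exp t) - exp (t / 2) * theta (exp (- t)))"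
  have *: "has_bochner_integral lborel (\<lambda>t. exp (- s * exp t) * h t) 0" if "0 < s" for s
    using has_bochner_integral_diff[OF theta_laplace[OF that] theta_inverse_laplace[OF that]]
    by (simp add: h_def right_diff_distrib)
  have "h t = 0"
  proof (rule laplace_exp_uniqueness[where h=h])
    show "continuous_on UNIV h"
      unfolding h_def using continuous_on_theta_exp[of 1] continuous_on_theta_exp[of "-1"]
      by (intro continuous_intros) auto
    show "integrable lborel (\<lambda>t. exp (- exp t) * h t)"
      using *[of 1] by (simp add: has_bochner_integral_iff)
    show "(\<integral>t. exp (- s * exp t) * h t \<partial>lborel) = 0" if "1 \<le> s" for s
      using *[of s] that by (simp add: has_bochner_integral_iff)
  qed
  then have "exp (t / 2) * (exp (t / 2) * theta (exp t)) = exp (t / 2) * theta (exp (- t))"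
    by (simp add: h_def flip: exp_add mult.assoc)
  then show ?thesis by simp
qed

section \<open>Powers of the theta function\<close>

definition theta_pow :: "nat \<Rightarrow> real \<Rightarrow> real" where
  "theta_pow k t = theta (exp t) ^ k"

lemma theta_pow_minus: "theta_pow k (- t) = exp (real k / 2 * t) * theta_pow k t"
  by (simp add: theta_pow_def theta_exp_minus power_mult_distrib flip: exp_of_nat_mult)

lemma theta_pow_ge_1: "1 \<le> theta_pow k t"
  unfolding theta_pow_def by (intro one_le_power theta_ge_1) auto

lemma continuous_on_theta_pow: "continuous_on UNIV (theta_pow k)"
  unfolding theta_pow_def[abs_def] using continuous_on_theta_exp[of 1] by (intro continuous_intros) auto

lemma continuous_on_theta_pow' [continuous_intros]:
  "continuous_on A f \<Longrightarrow> continuous_on A (\<lambda>x. theta_pow k (f x))"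
  by (rule continuous_on_compose2[OF continuous_on_theta_pow]) auto

lemma has_sum_theta_pow_lists:
  "((\<lambda>v. exp (- pi * exp t * real (sqnorm v))) has_sum theta_pow j t) {v. length v = j}"
proof -
  have "(\<Prod>n\<leftarrow>v. exp (- pi * exp t * (real_of_int n)\<^sup>2)) = exp (- pi * exp t * real (sqnorm v))" for v
  proof (induction v)
    case (Cons x v)
    have "real (sqnorm (x # v)) = real_of_int (int (sqnorm (x # v)))"
      by (simp only: of_int_of_nat_eq)
    also have "\<dots> = (real_of_int x)\<^sup>2 + real (sqnorm v)" unfolding sqnorm_Cons by simp
    finally show ?case using Cons by (simp add: algebra_simps flip: exp_add)
  qed simp
  then show ?thesis
    using has_sum_lists_power[OF has_sum_theta[of "exp t"], of j] by (simp add: theta_pow_def)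
qed

lemma has_sum_theta_pow_nonzero:
  "((\<lambda>v. exp (- pi * exp t * real (sqnorm v))) has_sum (theta_pow j t - 1)) {v. length v = j \<and> v \<noteq> replicate j 0}"
proof -
  have "((\<lambda>v. exp (- pi * exp t * real (sqnorm v))) has_sum 1) {replicate j 0}"
    using sqnorm_eq_0_iff[of "replicate j 0"] by (intro has_sum_finiteI) auto
  from has_sum_Diff[OF has_sum_theta_pow_lists this]
  show ?thesis by (simp add: Collect_conj_eq set_diff_eq Collect_neg_eq)
qed

lemma has_sum_theta_pow_r_sq:
  "((\<lambda>n. real (r_sq j n) * exp (- pi * exp t * real n)) has_sum (theta_pow j t - 1)) {1..}"
proof (rule has_sum_r_sq)
  have "{v. length v = j \<and> sqnorm v \<in> {1..}} = {v. length v = j \<and> v \<noteq> replicate j 0}"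
  proof (rule Collect_cong, rule conj_cong[OF refl])
    fix v :: "int list" assume "length v = j"
    then show "sqnorm v \<in> {1..} \<longleftrightarrow> v \<noteq> replicate j 0"
      using sqnorm_eq_0_iff[of v] by (metis One_nat_def Suc_le_eq atLeast_iff neq0_conv)
  qed
  then show "((\<lambda>v. exp (- pi * exp t * real (sqnorm v))) has_sum (theta_pow j t - 1))
     {v. length v = j \<and> sqnorm v \<in> {1..}}"
    using has_sum_theta_pow_nonzero by simp
qed

text \<open>The constant comes from 1 + u \<le> e^u at u = t - ln N, which reads N (1 + t - ln N)
  \<le> e^t and bounds e^(-e^t) by a multiple of e^(-N t). The factor 4 is 2 / (1/2), from the
  geometric bound with its denominator estimated below.\<close>

lemma theta_exp_bound:
  assumes N: "0 < N" and t: "0 \<le> t"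
  shows "theta (exp t) - 1 \<le> 4 * exp (N * ln N - N) * exp (- N * t)"
proof -
  have y: "1 \<le> exp t" using t by simp
  have "1 * exp t \<le> pi * exp t" using pi_gt3 by (intro mult_right_mono) auto
  then have le: "exp (- pi * exp t) \<le> exp (- exp t)" by simp
  have "exp (- exp t) \<le> exp (-1)" using y by simp
  moreover have "2 * exp (-1) \<le> (1::real)"
    using exp_ge_add_one_self[of "1::real"] by (simp add: exp_minus field_simps)
  ultimately have half: "exp (- pi * exp t) \<le> 1 / 2" using le by linarith
  have "theta (exp t) - 1 \<le> 2 * exp (- pi * exp t) / (1 - exp (- pi * exp t))"
    by (rule theta_le) simp
  also have "\<dots> \<le> 2 * exp (- pi * exp t) / (1 / 2)"
    using half by (intro divide_left_mono) auto
  also have "\<dots> \<le> 4 * exp (- exp t)" using le by simp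
  also have "exp (- exp t) \<le> exp (N * ln N - N) * exp (- N * t)"
  proof -
    have "1 + (t - ln N) \<le> exp (t - ln N)" by (rule exp_ge_add_one_self)
    then have "N * (1 + (t - ln N)) \<le> N * exp (t - ln N)" using N by (intro mult_left_mono) auto
    also have "\<dots> = exp t" using N by (simp add: exp_diff)
    finally show ?thesis by (simp add: algebra_simps flip: exp_add)
  qed
  finally show ?thesis by simp
qed

text \<open>Induction through theta^(k+1) - 1 = theta (theta^k - 1) + (theta - 1), with theta at
  most 1 + L for t \<ge> 0.\<close>

lemma theta_pow_bound_nonneg:
  assumes N: "0 < N"
  shows "\<exists>M\<ge>0. \<forall>t\<ge>0. theta_pow k t - 1 \<le> M * exp (- N * t)"
proof (induction k)
  case 0
  then show ?case by (auto intro!: exI[of _ 0] simp: theta_pow_def)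
next
  case (Suc k)
  then obtain M where M: "M \<ge> 0" "\<And>t. t \<ge> 0 \<Longrightarrow> theta_pow k t - 1 \<le> M * exp (- N * t)" by blast
  define L where "L = 4 * exp (N * ln N - N)"
  have L: "L \<ge> 0" "\<And>t. t \<ge> 0 \<Longrightarrow> theta (exp t) - 1 \<le> L * exp (- N * t)"
    using theta_exp_bound[OF N] by (auto simp: L_def)
  have "theta_pow (Suc k) t - 1 \<le> ((1 + L) * M + L) * exp (- N * t)" if t: "t \<ge> 0" for t
  proof -
    have "exp (- N * t) \<le> 1" using N t by simp
    then have "L * exp (- N * t) \<le> L" using L by (metis mult.right_neutral mult_left_mono)
    then have "theta (exp t) \<le> 1 + L" using L(2)[OF t] by linarith
    then have "theta (exp t) * (theta_pow k t - 1) \<le> (1 + L) * (M * exp (- N * t))"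
      using M(2)[OF t] theta_pow_ge_1[of k t] theta_ge_1[of "exp t"] L(1) by (intro mult_mono) auto
    moreover have "theta_pow (Suc k) t - 1 = theta (exp t) * (theta_pow k t - 1) + (theta (exp t) - 1)"
      by (simp add: theta_pow_def algebra_simps)
    ultimately show ?thesis using L(2)[OF t] by (simp add: algebra_simps)
  qed
  moreover have "(1 + L) * M + L \<ge> 0" using M L by simp
  ultimately show ?case by blast
qed

text \<open>For t < 0 the functional equation gives growth of order e^(-k t/2), absorbed by any N
  \<ge> k/2. The free exponent allows different choices at the two ends of the line.\<close>

lemma theta_pow_bound:
  assumes N: "0 < N" "real k / 2 \<le> N"
  obtains M where "0 \<le> M" "\<And>t. theta_pow k t - 1 \<le> M * exp (- N * t)"
proof -
  obtain M where M: "M \<ge> 0" "\<And>t. t \<ge> 0 \<Longrightarrow> theta_pow k t - 1 \<le> M * exp (- N * t)"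
    using theta_pow_bound_nonneg[OF N(1)] by blast
  have "theta_pow k t - 1 \<le> (1 + M) * exp (- N * t)" for t
  proof (cases "0 \<le> t")
    case True
    then show ?thesis using M(2)[OF True] exp_ge_zero[of "- N * t"] unfolding distrib_right by linarith
  next
    case False
    have "exp (- N * (- t)) \<le> 1" using N False by (simp add: mult_nonneg_nonpos)
    then have "M * exp (- N * (- t)) \<le> M" using M(1) by (metis mult.right_neutral mult_left_mono)
    then have "theta_pow k (- t) \<le> 1 + M" using M(2)[of "- t"] False by simp
    moreover have "exp (real k / 2 * (- t)) \<le> exp (N * (- t))"
      using False N by (simp only: exp_le_cancel_iff, intro mult_right_mono) auto
    ultimately have "exp (real k / 2 * (- t)) * theta_pow k (- t) \<le> exp (N * (- t)) * (1 + M)"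
      using theta_pow_ge_1[of k "- t"] by (intro mult_mono) auto
    then show ?thesis using theta_pow_minus[of k "- t"] by (simp add: mult.commute)
  qed
  with M(1) show ?thesis by (intro that[of "1 + M"]) auto
qed

section \<open>Exponential integrals over half lines\<close>

lemma has_bochner_integral_exp_atLeast_0:
  assumes "0 < (a::real)"
  shows "has_bochner_integral lborel (\<lambda>t. indicator {0..} t * exp (- a * t)) (1 / a)"
proof -
  have "((\<lambda>t. exp (- a * t)) has_integral 1 / a) {0..}"
    using has_integral_exp_minus_to_infinity[OF assms, of 0] by simp
  from nn_integral_has_integral_lebesgue[OF _ this]
  have "(\<integral>\<^sup>+t. ennreal (indicator {0..} t * exp (- a * t)) \<partial>lborel) = ennreal (1 / a)" by simp
  then show ?thesis
    by (intro has_bochner_integral_nn_integral) (use assms in auto)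
qed

lemma has_bochner_integral_exp_atMost_0:
  assumes "0 < (a::real)"
  shows "has_bochner_integral lborel (\<lambda>t. indicator {..0} t * exp (a * t)) (1 / a)"
proof -
  have "(indicator {0..} (0 - t) :: real) = indicator {..0} t" for t :: real
    by (auto simp: indicator_def)
  then show ?thesis
    using has_bochner_integral_lborel_reflect[OF has_bochner_integral_exp_atLeast_0[OF assms], of 0] by simp
qed

lemma integrable_exp_abs:
  assumes "0 < (a::real)"
  shows "integrable lborel (\<lambda>t. exp (- a * \<bar>t\<bar>))"
proof (rule Bochner_Integration.integrable_bound)
  show "integrable lborel (\<lambda>t. indicator {0..} t * exp (- a * t) + indicator {..0} t * exp (a * t))"
    using has_bochner_integral_exp_atLeast_0[OF assms] has_bochner_integral_exp_atMost_0[OF assms]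
    by (auto simp: has_bochner_integral_iff)
  show "AE t in lborel. norm (exp (- a * \<bar>t\<bar>)) \<le> norm (indicator {0..} t * exp (- a * t) + indicator {..0} t * exp (a * t))"
    by (intro AE_I2) (auto simp: indicator_def)
qed auto

section \<open>The double Bessel series\<close>

definition theta_conv :: "nat \<Rightarrow> real \<Rightarrow> real" where
  "theta_conv k l = (\<integral>t. (theta_pow k (l + t) - 1) * (theta_pow k (l - t) - 1) \<partial>lborel)"

text \<open>Bounding one factor with exponent N + 1 and the other with N leaves e^(-t); as the
  integrand is even in t, this controls both ends.\<close>

lemma integrable_theta_conv:
  "integrable lborel (\<lambda>t. (theta_pow k (l + t) - 1) * (theta_pow k (l - t) - 1))"
proof -
  define N where "N = real k / 2 + 1"
  have N: "0 < N + 1" "real k / 2 \<le> N + 1" "0 < N" "real k / 2 \<le> N" by (auto simp: N_def)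
  obtain M1 where M1: "M1 \<ge> 0" "\<And>t. theta_pow k t - 1 \<le> M1 * exp (- (N + 1) * t)"
    using theta_pow_bound[OF N(1,2)] by blast
  obtain M2 where M2: "M2 \<ge> 0" "\<And>t. theta_pow k t - 1 \<le> M2 * exp (- N * t)"
    using theta_pow_bound[OF N(3,4)] by blast
  define C where "C = M1 * M2 * exp (- (2 * N + 1) * l)"
  have C: "C \<ge> 0" using M1 M2 by (simp add: C_def)
  have b: "(theta_pow k (l + t) - 1) * (theta_pow k (l - t) - 1) \<le> C * exp (- t)" for t
  proof -
    have "(theta_pow k (l + t) - 1) * (theta_pow k (l - t) - 1)
       \<le> (M1 * exp (- (N + 1) * (l + t))) * (M2 * exp (- N * (l - t)))"
      using M1 M2 theta_pow_ge_1[of k] by (intro mult_mono) auto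
    also have "\<dots> = C * exp (- t)"
      by (simp add: C_def algebra_simps flip: exp_add)
    finally show ?thesis .
  qed
  have b': "(theta_pow k (l + t) - 1) * (theta_pow k (l - t) - 1) \<le> C * exp (- 1 * \<bar>t\<bar>)" for t
  proof (cases "t \<ge> 0")
    case True
    then show ?thesis using b[of t] by simp
  next
    case False
    then show ?thesis using b[of "- t"] by (simp add: mult.commute)
  qed
  show ?thesis
  proof (rule Bochner_Integration.integrable_bound)
    show "integrable lborel (\<lambda>t. C * exp (- 1 * \<bar>t\<bar>))"
      using integrable_exp_abs[of 1] by simp
    have "(\<lambda>t. (theta_pow k (l + t) - 1) * (theta_pow k (l - t) - 1)) \<in> borel_measurable borel"
      by (intro borel_measurable_continuous_onI continuous_intros)
    then show "(\<lambda>t. (theta_pow k (l + t) - 1) * (theta_pow k (l - t) - 1)) \<in> borel_measurable lborel"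
      by simp
    show "AE t in lborel. norm ((theta_pow k (l + t) - 1) * (theta_pow k (l - t) - 1)) \<le> norm (C * exp (- 1 * \<bar>t\<bar>))"
    proof (rule AE_I2)
      fix t
      have "0 \<le> (theta_pow k (l + t) - 1) * (theta_pow k (l - t) - 1)"
        using theta_pow_ge_1[of k] by (intro mult_nonneg_nonneg) auto
      then show "norm ((theta_pow k (l + t) - 1) * (theta_pow k (l - t) - 1)) \<le> norm (C * exp (- 1 * \<bar>t\<bar>))"
        unfolding real_norm_def using b'[of t] C by (metis abs_ge_self abs_of_nonneg order_trans)
    qed
  qed
qed

text \<open>Expanding both factors yields the terms exp (- a e^t - b e^(-t)) with a = pi e^l m and b
  = pi e^l n, so sqrt (a b) = sqrt (m n) pi e^l. Each integrates to 2 K_0, which explains the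
  half.\<close>

lemma bessel_double_sum:
  "((\<lambda>(m, n). real (r_sq k m) * real (r_sq k n) * besselK0 (2 * sqrt (real (m * n)) * (pi * exp l)))
     has_sum (theta_conv k l / 2)) ({1..} \<times> {1..})"
proof -
  define c where "c = (\<lambda>(m, n). real (r_sq k m) * real (r_sq k n) * besselK0 (2 * sqrt (real (m * n)) * (pi * exp l)))"
  define f where "f = (\<lambda>(m, n) t. (real (r_sq k m) * exp (- pi * exp (l + t) * real m)) *
      (real (r_sq k n) * exp (- pi * exp (l - t) * real n)))"
  have "((\<lambda>i. 2 * c i) has_sum (theta_conv k l)) ({1..} \<times> {1..})"
  proof (rule has_bochner_integral_has_sum_iff[where f=f, THEN iffD1])
    show "has_bochner_integral lborel (f i) (2 * c i)" if i: "i \<in> {1..} \<times> {1..}" for i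
    proof -
      obtain m n where mn: "i = (m, n)" "m \<ge> 1" "n \<ge> 1" using i by auto
      define a where "a = pi * exp l * real m"
      define b where "b = pi * exp l * real n"
      have ab: "0 < a" "0 < b" using mn by (auto simp: a_def b_def)
      have "sqrt (a * b) = sqrt (real (m * n) * (pi * exp l)\<^sup>2)"
        by (simp add: a_def b_def power2_eq_square mult_ac)
      also have "\<dots> = sqrt (real (m * n)) * (pi * exp l)"
        by (simp only: real_sqrt_mult real_sqrt_abs) simp
      finally have sq: "2 * sqrt (a * b) = 2 * sqrt (real (m * n)) * (pi * exp l)" by simp
      have "has_bochner_integral lborel (\<lambda>t. (real (r_sq k m) * real (r_sq k n)) * exp (- a * exp t - b * exp (- t)))
          ((real (r_sq k m) * real (r_sq k n)) * (2 * besselK0 (2 * sqrt (a * b))))"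
        by (intro has_bochner_integral_mult_right has_bochner_integral_besselK0 ab)
      also have "(\<lambda>t. (real (r_sq k m) * real (r_sq k n)) * exp (- a * exp t - b * exp (- t))) = f i"
      proof
        fix t
        have "exp (- a * exp t - b * exp (- t)) = exp (- pi * exp (l + t) * real m) * exp (- pi * exp (l - t) * real n)"
        proof -
          have e: "exp (l + t) = exp l * exp t" "exp (l - t) = exp l * exp (- t)"
            by (simp_all flip: exp_add)
          have "- a * exp t - b * exp (- t) = - pi * exp (l + t) * real m + - pi * exp (l - t) * real n"
            unfolding e a_def b_def by (simp add: mult_ac)
          then show ?thesis by (simp only: exp_add)
        qed
        then show "(real (r_sq k m) * real (r_sq k n)) * exp (- a * exp t - b * exp (- t)) = f i t"
          by (simp add: f_def mn)
      qed
      also have "(real (r_sq k m) * real (r_sq k n)) * (2 * besselK0 (2 * sqrt (a * b))) = 2 * c i"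
        unfolding sq by (simp add: c_def mn)
      finally show ?thesis .
    qed
    show "((\<lambda>i. f i t) has_sum (theta_pow k (l + t) - 1) * (theta_pow k (l - t) - 1)) ({1..} \<times> {1..})" for t
      using has_sum_product_nonneg[OF has_sum_theta_pow_r_sq[of k "l + t"] has_sum_theta_pow_r_sq[of k "l - t"]]
      by (simp add: f_def case_prod_unfold)
    show "has_bochner_integral lborel (\<lambda>t. (theta_pow k (l + t) - 1) * (theta_pow k (l - t) - 1)) (theta_conv k l)"
      using integrable_theta_conv by (simp add: has_bochner_integral_iff theta_conv_def)
    show "(\<lambda>t. (theta_pow k (l + t) - 1) * (theta_pow k (l - t) - 1)) \<in> borel_measurable lborel"
      by (rule borel_measurable_integrable[OF integrable_theta_conv])
  qed (auto simp: f_def)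
  from has_sum_cmult_right[OF this, of "1 / 2"] show ?thesis
    by (simp add: c_def case_prod_unfold)
qed

section \<open>The regularised integral and the reflection formula\<close>

definition theta_reg :: "nat \<Rightarrow> real \<Rightarrow> real" where
  "theta_reg k t = theta_pow k t - (if 0 \<le> t then 1 else exp (- (real k / 2) * t))"

text \<open>The functional equation exchanges the two subtracted asymptotics, 1 for t \<ge> 0 and
  e^(-k t/2) for t < 0, so the regularised function inherits it.\<close>

lemma theta_reg_minus: "theta_reg k (- t) = exp (real k / 2 * t) * theta_reg k t"
  by (auto simp: theta_reg_def theta_pow_minus right_diff_distrib simp flip: exp_add)

lemma theta_reg_measurable [measurable]: "theta_reg k \<in> borel_measurable borel"
proof -
  have [measurable]: "theta_pow k \<in> borel_measurable borel"
    by (rule borel_measurable_continuous_onI[OF continuous_on_theta_pow])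
  show ?thesis unfolding theta_reg_def[abs_def] by measurable
qed

text \<open>The exponent k/2 + 1 is chosen so that on the negative side, after the factor e^(k
  |t|/2) of the reflection, a decay e^(-|t|) remains.\<close>

lemma theta_reg_bound:
  obtains M where "0 \<le> M" "\<And>t. 0 \<le> theta_reg k t" "\<And>t. theta_reg k t \<le> M * exp (- 1 * \<bar>t\<bar>)"
proof -
  define N where "N = real k / 2 + 1"
  have N: "0 < N" "real k / 2 \<le> N" by (auto simp: N_def)
  obtain M where M: "M \<ge> 0" "\<And>t. theta_pow k t - 1 \<le> M * exp (- N * t)"
    using theta_pow_bound[OF N] by blast
  have nn: "0 \<le> theta_reg k t" if "0 \<le> t" for t
    using that theta_pow_ge_1[of k t] by (simp add: theta_reg_def)
  have le: "theta_reg k t \<le> M * exp (- N * t)" if "0 \<le> t" for t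
    using that M(2)[of t] by (simp add: theta_reg_def)
  show ?thesis
  proof (rule that[OF M(1)])
    show "0 \<le> theta_reg k t" for t
      using nn[of t] nn[of "- t"] theta_reg_minus[of k "- t"] by (cases "0 \<le> t") auto
    show "theta_reg k t \<le> M * exp (- 1 * \<bar>t\<bar>)" for t
    proof (cases "0 \<le> t")
      case True
      then have "exp (- N * t) \<le> exp (- 1 * \<bar>t\<bar>)" by (simp add: N_def algebra_simps)
      then show ?thesis using le[OF True] M(1) by (meson mult_left_mono order_trans)
    next
      case False
      have "theta_reg k t = exp (real k / 2 * (- t)) * theta_reg k (- t)"
        using theta_reg_minus[of k "- t"] by simp
      also have "\<dots> \<le> exp (real k / 2 * (- t)) * (M * exp (- N * (- t)))"
        using le[of "- t"] False by (intro mult_left_mono) auto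
      also have "\<dots> = M * exp (- 1 * \<bar>t\<bar>)"
        using False by (simp add: N_def algebra_simps flip: exp_add)
      finally show ?thesis .
    qed
  qed
qed

definition theta_const :: "nat \<Rightarrow> real" where
  "theta_const k = (\<integral>t. theta_reg k t \<partial>lborel)"

lemma has_bochner_integral_theta_reg: "has_bochner_integral lborel (theta_reg k) (theta_const k)"
proof -
  obtain M where M: "M \<ge> 0" "\<And>t. 0 \<le> theta_reg k t" "\<And>t. theta_reg k t \<le> M * exp (- 1 * \<bar>t\<bar>)"
    using theta_reg_bound[of k] by blast
  have "integrable lborel (theta_reg k)"
  proof (rule Bochner_Integration.integrable_bound)
    show "integrable lborel (\<lambda>t. M * exp (- 1 * \<bar>t\<bar>))"
      using integrable_exp_abs[of 1] by simp
    show "AE t in lborel. norm (theta_reg k t) \<le> norm (M * exp (- 1 * \<bar>t\<bar>))"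
      using M by (intro AE_I2) auto
  qed simp
  then show ?thesis by (simp add: has_bochner_integral_iff theta_const_def)
qed

text \<open>The elementary remainder of the reflection formula lives on [-l, l]; its integral is the
  source of the terms 2/k and 2 l there.\<close>

lemma has_bochner_integral_Icc_cosh:
  fixes h l c :: real
  assumes "0 < h" "0 < l"
  shows "has_bochner_integral lborel
     (\<lambda>t. indicator {- l..l} t * (exp (- h * l) * (exp (h * t) + exp (- h * t)) - c))
     (2 / h * (1 - exp (- 2 * h * l)) - 2 * l * c)"
proof -
  define P where "P = (\<lambda>t. exp (- h * l) * ((exp (h * t) - exp (- h * t)) / h) - c * t)"
  have "has_bochner_integral lborel
     (\<lambda>t. indicator {- l..l} t *\<^sub>R (exp (- h * l) * (exp (h * t) + exp (- h * t)) - c)) (P l - P (- l))"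
  proof (rule has_bochner_integral_FTC_Icc)
    show "(P has_vector_derivative exp (- h * l) * (exp (h * x) + exp (- h * x)) - c) (at x within {- l..l})" for x
      unfolding P_def using assms
      by (auto intro!: derivative_eq_intros simp: has_real_derivative_iff_has_vector_derivative[symmetric] field_simps)
  qed (use assms in \<open>auto intro!: continuous_intros\<close>)
  also have "P l - P (- l) = 2 / h * (1 - exp (- 2 * h * l)) - 2 * l * c"
  proof -
    have "exp (- h * l) * exp (h * l) = 1" "exp (- h * l) * exp (- h * l) = exp (- 2 * h * l)"
      by (simp_all flip: exp_add)
    then show ?thesis using assms(1) by (simp add: P_def field_simps)
  qed
  finally show ?thesis by simp
qed

text \<open>With p = e^(h(l+t)) and q = e^(h(l-t)), the functional equation turns c G(-l+t) G(-l-t)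
  into c p q G(l+t) G(l-t), and c p q = 1, so the quadratic terms cancel. The linear ones are four
  shifted or reflected copies of \<open>theta_reg\<close>, each with integral
  \<open>theta_const k\<close>, up to an elementary function.\<close>

lemma theta_conv_reflect_pos:
  assumes k: "1 \<le> k" and l: "0 < l"
  defines "c \<equiv> exp (- real k * l)"
  shows "theta_conv k l + 2 * (theta_const k - 2 / real k) + 2 * l
       = c * (theta_conv k (- l) + 2 * (theta_const k - 2 / real k) - 2 * l)"
proof -
  define h where "h = real k / 2"
  have h: "0 < h" using k by (simp add: h_def)
  have c: "c = exp (- 2 * h * l)" by (simp add: c_def h_def)
  have F: "has_bochner_integral lborel (\<lambda>t. (theta_pow k (l' + t) - 1) * (theta_pow k (l' - t) - 1)) (theta_conv k l')" for l'
    using integrable_theta_conv by (simp add: has_bochner_integral_iff theta_conv_def)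
  note w = has_bochner_integral_theta_reg[of k]
  define J where "J = 2 / h * (1 - c) - 2 * l * (1 + c)"
  \<comment> \<open>\<open>j\<close> collects all elementary terms. Beyond [-l, l] exactly one of l
    + t and l - t is negative, and then c p q = 1 makes these terms cancel.\<close>
  define j where "j = (\<lambda>t. indicator {- l..l} t * (exp (- h * l) * (exp (h * t) + exp (- h * t)) - (1 + c)))"
  have lhs: "has_bochner_integral lborel (\<lambda>t. (theta_pow k (l + t) - 1) * (theta_pow k (l - t) - 1)
       - c * ((theta_pow k (- l + t) - 1) * (theta_pow k (- l - t) - 1))) (theta_conv k l - c * theta_conv k (- l))"
    by (intro has_bochner_integral_diff has_bochner_integral_mult_right F)
  have "has_bochner_integral lborel (\<lambda>t. j t - (theta_reg k (l + t) + theta_reg k (l - t))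
       + c * (theta_reg k (- l + t) + theta_reg k (- l - t)))
      (J - (theta_const k + theta_const k) + c * (theta_const k + theta_const k))"
    unfolding j_def J_def c
    by (intro has_bochner_integral_add has_bochner_integral_diff has_bochner_integral_mult_right
          has_bochner_integral_lborel_shift has_bochner_integral_lborel_reflect w has_bochner_integral_Icc_cosh h l)
  also have "(\<lambda>t. j t - (theta_reg k (l + t) + theta_reg k (l - t))
       + c * (theta_reg k (- l + t) + theta_reg k (- l - t)))
     = (\<lambda>t. (theta_pow k (l + t) - 1) * (theta_pow k (l - t) - 1)
       - c * ((theta_pow k (- l + t) - 1) * (theta_pow k (- l - t) - 1)))"
  proof
    fix t
    define p where "p = exp (h * (l + t))"
    define q where "q = exp (h * (l - t))"
    define gA where "gA = (if 0 \<le> l + t then 1 else exp (- h * (l + t)))"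
    define gB where "gB = (if 0 \<le> l - t then 1 else exp (- h * (l - t)))"
    have pqc: "c * p * q = 1" by (simp add: c p_def q_def algebra_simps flip: exp_add)
    have cp: "c * p = exp (- h * (l - t))" and cq: "c * q = exp (- h * (l + t))"
      by (simp_all add: c p_def q_def algebra_simps flip: exp_add)
    have A: "theta_reg k (l + t) = theta_pow k (l + t) - gA" and B: "theta_reg k (l - t) = theta_pow k (l - t) - gB"
      by (simp_all add: theta_reg_def gA_def gB_def h_def)
    have A': "theta_reg k (- l - t) = p * theta_reg k (l + t)"
      and B': "theta_reg k (- l + t) = q * theta_reg k (l - t)"
      using theta_reg_minus[of k "l + t"] theta_reg_minus[of k "l - t"] by (simp_all add: p_def q_def h_def)
    have A'': "theta_pow k (- l - t) = p * theta_pow k (l + t)"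
      and B'': "theta_pow k (- l + t) = q * theta_pow k (l - t)"
      using theta_pow_minus[of k "l + t"] theta_pow_minus[of k "l - t"] by (simp_all add: p_def q_def h_def)
    have jt: "j t = 1 - c - gA - gB + c * (p * gA + q * gB)"
    proof -
      consider "- l \<le> t \<and> t \<le> l" | "l < t" | "t < - l" by linarith
      then show ?thesis
      proof cases
        case 1
        have "c * p = exp (- h * l) * exp (h * t)" "c * q = exp (- h * l) * exp (- h * t)"
          unfolding cp cq by (simp_all add: algebra_simps flip: exp_add)
        then show ?thesis using 1 by (simp add: j_def gA_def gB_def algebra_simps)
      next
        case 2
        then have "gA = 1" "gB = c * p" "j t = 0" using l by (auto simp: gA_def gB_def cp j_def)
        then show ?thesis using pqc by (simp add: algebra_simps)
      next
        case 3
        then have "gA = c * q" "gB = 1" "j t = 0" using l by (auto simp: gA_def gB_def cq j_def)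
        then show ?thesis using pqc by (simp add: algebra_simps)
      qed
    qed
    have "c * ((q * theta_pow k (l - t) - 1) * (p * theta_pow k (l + t) - 1))
        = (c * p * q) * (theta_pow k (l - t) * theta_pow k (l + t))
          - c * (q * theta_pow k (l - t) + p * theta_pow k (l + t)) + c"
      by (simp add: algebra_simps)
    then show "j t - (theta_reg k (l + t) + theta_reg k (l - t))
       + c * (theta_reg k (- l + t) + theta_reg k (- l - t))
      = (theta_pow k (l + t) - 1) * (theta_pow k (l - t) - 1)
       - c * ((theta_pow k (- l + t) - 1) * (theta_pow k (- l - t) - 1))"
      unfolding A' B' A'' B'' A B jt pqc by (simp add: algebra_simps)
  qed
  finally have "theta_conv k l - c * theta_conv k (- l)
      = J - (theta_const k + theta_const k) + c * (theta_const k + theta_const k)"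
    using lhs has_bochner_integral_eq by blast
  moreover define u where "u = 2 / real k"
  moreover have "J = 2 * u * (1 - c) - 2 * l * (1 + c)" by (simp add: J_def h_def u_def)
  ultimately show ?thesis unfolding u_def[symmetric] by (simp add: algebra_simps)
qed

lemma theta_conv_reflect:
  assumes k: "1 \<le> k"
  shows "theta_conv k l + 2 * (theta_const k - 2 / real k) + 2 * l
       = exp (- real k * l) * (theta_conv k (- l) + 2 * (theta_const k - 2 / real k) - 2 * l)"
proof -
  consider "l > 0" | "l = 0" | "- l > 0" by linarith
  then show ?thesis
  proof cases
    \<comment> \<open>The positive case at - l, multiplied by exp (- k l).\<close>
    case 3
    have "exp (- real k * l) * exp (real k * l) = 1" by (simp flip: exp_add)
    then show ?thesis using theta_conv_reflect_pos[OF k 3] by (simp flip: mult.assoc)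
  qed (use theta_conv_reflect_pos[OF k] in auto)
qed

section \<open>The Kronecker limit formula\<close>

text \<open>\<open>d\<close> is half the distance of s from the abscissa j/2; the exponents s + d
  and s - d give the decay e^(-d |t|) at the two ends.\<close>

lemma integrable_exp_theta_pow:
  assumes s: "0 < s" "real j / 2 < s"
  shows "integrable lborel (\<lambda>t. exp (s * t) * (theta_pow j t - 1))"
proof -
  define d where "d = (s - real j / 2) / 2"
  have d: "0 < d" using s by (simp add: d_def)
  have N: "0 < s + d" "real j / 2 \<le> s + d" "0 < s - d" "real j / 2 \<le> s - d"
    using s by (auto simp: d_def field_simps)
  obtain M1 where M1: "M1 \<ge> 0" "\<And>t. theta_pow j t - 1 \<le> M1 * exp (- (s + d) * t)"
    using theta_pow_bound[OF N(1,2)] by blast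
  obtain M2 where M2: "M2 \<ge> 0" "\<And>t. theta_pow j t - 1 \<le> M2 * exp (- (s - d) * t)"
    using theta_pow_bound[OF N(3,4)] by blast
  show ?thesis
  proof (rule Bochner_Integration.integrable_bound)
    show "integrable lborel (\<lambda>t. (M1 + M2) * exp (- d * \<bar>t\<bar>))"
      using integrable_exp_abs[OF d] by simp
    have "(\<lambda>t. exp (s * t) * (theta_pow j t - 1)) \<in> borel_measurable borel"
      by (intro borel_measurable_continuous_onI continuous_intros)
    then show "(\<lambda>t. exp (s * t) * (theta_pow j t - 1)) \<in> borel_measurable lborel" by simp
    show "AE t in lborel. norm (exp (s * t) * (theta_pow j t - 1)) \<le> norm ((M1 + M2) * exp (- d * \<bar>t\<bar>))"
    proof (rule AE_I2)
      fix t
      have "exp (s * t) * (theta_pow j t - 1) \<le> (M1 + M2) * exp (- d * \<bar>t\<bar>)"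
      proof (cases "0 \<le> t")
        case True
        have "exp (s * t) * (theta_pow j t - 1) \<le> exp (s * t) * (M1 * exp (- (s + d) * t))"
          using M1 by (intro mult_left_mono) auto
        also have "\<dots> = M1 * exp (- d * \<bar>t\<bar>)"
          using True by (simp add: algebra_simps flip: exp_add)
        finally show ?thesis using M2(1) by (simp add: distrib_right add_increasing2)
      next
        case False
        have "exp (s * t) * (theta_pow j t - 1) \<le> exp (s * t) * (M2 * exp (- (s - d) * t))"
          using M2 by (intro mult_left_mono) auto
        also have "\<dots> = M2 * exp (- d * \<bar>t\<bar>)"
          using False by (simp add: algebra_simps flip: exp_add)
        finally show ?thesis using M1(1) by (simp add: distrib_right add_increasing)
      qed
      moreover have "0 \<le> exp (s * t) * (theta_pow j t - 1)"
        using theta_pow_ge_1[of j t] by simp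
      ultimately show "norm (exp (s * t) * (theta_pow j t - 1)) \<le> norm ((M1 + M2) * exp (- d * \<bar>t\<bar>))"
        unfolding real_norm_def by linarith
    qed
  qed
qed

text \<open>The Mellin transform of theta^j - 1. Its integrability, known from the bounds on theta,
  proves that the Dirichlet series converges, so the \<open>suminf\<close> in \<open>zeta_sq\<close>
  is a true sum.\<close>

lemma has_bochner_integral_eta_sq:
  assumes s: "0 < s" "real j / 2 < s"
  shows "has_bochner_integral lborel (\<lambda>t. exp (s * t) * (theta_pow j t - 1)) (eta_sq j s)"
proof -
  define V where "V = (\<integral>t. exp (s * t) * (theta_pow j t - 1) \<partial>lborel)"
  have V: "has_bochner_integral lborel (\<lambda>t. exp (s * t) * (theta_pow j t - 1)) V"
    using integrable_exp_theta_pow[OF s] by (simp add: has_bochner_integral_iff V_def)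
  define C where "C = pi powr (- s) * Gamma s"
  have C: "C > 0" using s by (simp add: C_def)
  have "((\<lambda>n. C * (real (r_sq j n) / real n powr s)) has_sum V) {1..}"
  proof (rule has_bochner_integral_has_sum_iff[THEN iffD1, OF _ _ _ _ _ V])
    show "has_bochner_integral lborel (\<lambda>t. real (r_sq j n) * (exp (- (pi * real n) * exp t) * exp (s * t)))
        (C * (real (r_sq j n) / real n powr s))" if "n \<in> {1..}" for n
    proof -
      have "has_bochner_integral lborel (\<lambda>t. real (r_sq j n) * (exp (- (pi * real n) * exp t) * exp (s * t)))
          (real (r_sq j n) * (Gamma s / (pi * real n) powr s))"
        using that s by (intro has_bochner_integral_mult_right has_bochner_integral_Gamma_exp) auto
      also have "real (r_sq j n) * (Gamma s / (pi * real n) powr s) = C * (real (r_sq j n) / real n powr s)"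
        by (simp add: C_def powr_mult powr_minus field_simps)
      finally show ?thesis .
    qed
    show "((\<lambda>n. real (r_sq j n) * (exp (- (pi * real n) * exp t) * exp (s * t))) has_sum
        exp (s * t) * (theta_pow j t - 1)) {1..}" for t
      using has_sum_cmult_right[OF has_sum_theta_pow_r_sq[of j t], of "exp (s * t)"]
      by (simp add: mult_ac)
    show "(\<lambda>t. exp (s * t) * (theta_pow j t - 1)) \<in> borel_measurable lborel"
      by (rule borel_measurable_integrable[OF integrable_exp_theta_pow[OF s]])
  qed auto
  from has_sum_cmult_right[OF this, of "1 / C"]
  have "((\<lambda>n. real (r_sq j n) / real n powr s) has_sum (V / C)) {1..}"
    using C by simp
  moreover have "{1..} = range Suc" by (auto simp: image_iff Suc_le_eq dest: gr0_implies_Suc)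
  ultimately have "((\<lambda>n. real (r_sq j (Suc n)) / real (Suc n) powr s) has_sum (V / C)) UNIV"
    by (simp add: has_sum_reindex o_def)
  then have "zeta_sq j s = V / C"
    unfolding zeta_sq_def by (intro sums_unique[symmetric] has_sum_imp_sums)
  then have "eta_sq j s = V"
    using C unfolding eta_sq_def C_def[symmetric] by simp
  with V show ?thesis by simp
qed

lemma has_sum_ln_one_minus:
  fixes q :: real
  assumes "0 < q" "q < 1"
  shows "((\<lambda>n. q ^ n / real n) has_sum (- ln (1 - q))) {1..}"
proof -
  \<comment> \<open>The term n = 0 is 1/0 = 0, so the index may start at 0 or at 1.\<close>
  have "(\<lambda>n. q ^ n / real n) sums (- ln (1 - q))"
    using sums_minus[OF ln_series'[of "- q"]] assms by simp
  then have "((\<lambda>n. q ^ n / real n) has_sum (- ln (1 - q))) UNIV"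
    using assms by (intro sums_nonneg_imp_has_sum) auto
  also have "?this \<longleftrightarrow> ?thesis"
    by (rule has_sum_cong_neutral) auto
  finally show ?thesis .
qed

text \<open>The boxes eventually contain every finite set of vectors, so summability of the
  logarithms gives existence, positivity and value of the limit that defines \<open>Phi\<close>. For
  k = 1 the index set is empty.\<close>

lemma ln_Phi:
  assumes "((\<lambda>v. - 2 * ln (1 - exp (- 2 * pi * int_vec_norm v))) has_sum X)
     {v. length v = k - 1 \<and> v \<noteq> replicate (k - 1) 0}"
  shows "ln (Phi k) = - X / 2"
proof -
  define V where "V = {v :: int list. length v = k - 1 \<and> v \<noteq> replicate (k - 1) 0}"
  define B where "B = (\<lambda>N::nat. {v :: int list. length v = k - 1 \<and> v \<noteq> replicate (k - 1) 0
        \<and> (\<forall>x\<in>set v. \<bar>x\<bar> \<le> int N)})"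
  define q where "q = (\<lambda>v. exp (- 2 * pi * int_vec_norm v))"
  have q: "q v < 1" if "v \<in> V" for v
  proof -
    have "sqnorm v \<noteq> 0" using that sqnorm_eq_0_iff[of v] by (auto simp: V_def)
    then show ?thesis by (simp add: q_def int_vec_norm_eq)
  qed
  have finB: "finite (B N)" for N
  proof (rule finite_subset)
    show "B N \<subseteq> {v. set v \<subseteq> {- int N..int N} \<and> length v = k - 1}"
      by (auto simp: B_def abs_le_iff)
  qed (rule finite_lists_length_eq, simp)
  have BV: "B N \<subseteq> V" for N by (auto simp: B_def V_def)
  have "filterlim B (finite_subsets_at_top V) sequentially"
    unfolding filterlim_finite_subsets_at_top
  proof (intro allI impI)
    fix X assume X: "finite X \<and> X \<subseteq> V"
    \<comment> \<open>Entries of a vector are bounded by its squared norm, hence by the sum of all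
      squared norms in the finite set.\<close>
    define K where "K = (\<Sum>v\<in>X. sqnorm v)"
    have "X \<subseteq> B N" if "N \<ge> K" for N
    proof
      fix v assume v: "v \<in> X"
      have "sqnorm v \<le> K" unfolding K_def using X v by (intro member_le_sum) auto
      then have "\<bar>x\<bar> \<le> int N" if "x \<in> set v" for x
        using abs_le_sqnorm[OF that] \<open>N \<ge> K\<close> by linarith
      then show "v \<in> B N" using v X by (auto simp: B_def V_def)
    qed
    then show "\<forall>\<^sub>F N in sequentially. finite (B N) \<and> X \<subseteq> B N \<and> B N \<subseteq> V"
      using finB BV by (auto simp: eventually_sequentially)
  qed
  moreover have "(sum (\<lambda>v. - 2 * ln (1 - q v)) \<longlongrightarrow> X) (finite_subsets_at_top V)"
    using assms unfolding has_sum_def V_def q_def .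
  ultimately have "(\<lambda>N. \<Sum>v\<in>B N. - 2 * ln (1 - q v)) \<longlonglongrightarrow> X"
    by (rule filterlim_compose[rotated])
  then have "(\<lambda>N. exp (- (\<Sum>v\<in>B N. - 2 * ln (1 - q v)) / 2)) \<longlonglongrightarrow> exp (- X / 2)"
    by (intro tendsto_intros) auto
  moreover have "exp (- (\<Sum>v\<in>B N. - 2 * ln (1 - q v)) / 2) = (\<Prod>v\<in>B N. 1 - q v)" for N
  proof -
    have "(\<Sum>v\<in>B N. - 2 * ln (1 - q v)) = - 2 * (\<Sum>v\<in>B N. ln (1 - q v))"
      by (rule sum_distrib_left[symmetric])
    then have "- (\<Sum>v\<in>B N. - 2 * ln (1 - q v)) / 2 = (\<Sum>v\<in>B N. ln (1 - q v))"
      by linarith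
    also have "exp \<dots> = (\<Prod>v\<in>B N. exp (ln (1 - q v)))" using finB by (rule exp_sum)
    also have "\<dots> = (\<Prod>v\<in>B N. 1 - q v)"
      using q BV by (intro prod.cong) (auto simp: subset_iff)
    finally show ?thesis .
  qed
  ultimately have "Phi k = exp (- X / 2)"
    unfolding Phi_def B_def q_def by (intro limI) simp
  then show ?thesis by simp
qed

lemma theta_reg_uminus_eq:
  "theta_reg k (- t) = exp (real k / 2 * t) * theta_pow k t - (if 0 \<le> t then exp (real k / 2 * t) else 1)"
  by (auto simp: theta_reg_def theta_pow_minus)

text \<open>\<open>U\<close> is the cross term e^(t/2) (theta(e^t) - 1) (theta(e^(-t))^j - 1).
  Multiplied out, with the functional equation applied to j factors, its four terms yield after
  regularisation \<open>theta_const k\<close>, \<open>theta_const 1\<close>,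
  \<open>eta_sq j h\<close> and the elementary 1/h - 2.\<close>

lemma kronecker_limit_theta_const:
  assumes k: "1 \<le> k"
  shows "theta_const k - 2 / real k = eta_sq (k - 1) (real k / 2) + (theta_const 1 - 2) - 2 * ln (Phi k)"
proof -
  define j where "j = k - 1"
  have kj: "k = Suc j" "real k = real j + 1" using k by (auto simp: j_def)
  define h where "h = real k / 2"
  have h: "0 < h" "real j / 2 < h" "h = real j / 2 + 1 / 2" by (auto simp: h_def kj)
  define X where "X = theta_const k - theta_const 1 - eta_sq j h - (1 / h - 1 / (1 / 2))"
  define V where "V = {v :: int list. length v = j \<and> v \<noteq> replicate j 0}"
  define U where "U = (\<lambda>t. exp (t / 2) * (theta (exp t) - 1) * (theta_pow j (- t) - 1))"
  define c where "c = (\<lambda>(v, n). 2 * (exp (- 2 * pi * int_vec_norm v) ^ n / real n))"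
  \<comment> \<open>The reflected form carries the weights e^(h t) and e^(t/2), matching the Mellin
    integral of \<open>eta_sq\<close>.\<close>
  have w: "has_bochner_integral lborel (\<lambda>t. theta_reg i (- t)) (theta_const i)" for i
    using has_bochner_integral_lborel_reflect[OF has_bochner_integral_theta_reg, of i 0] by simp
  have "has_bochner_integral lborel (\<lambda>t. theta_reg k (- t) - theta_reg 1 (- t) - exp (h * t) * (theta_pow j t - 1)
      - (indicator {..0} t * exp (h * t) - indicator {..0} t * exp (1 / 2 * t))) X"
    unfolding X_def
    by (intro has_bochner_integral_diff w has_bochner_integral_eta_sq has_bochner_integral_exp_atMost_0 h) auto
  also have "(\<lambda>t. theta_reg k (- t) - theta_reg 1 (- t) - exp (h * t) * (theta_pow j t - 1)
      - (indicator {..0} t * exp (h * t) - indicator {..0} t * exp (1 / 2 * t))) = U"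
  proof
    fix t
    have "theta_pow k t = theta (exp t) * theta_pow j t" by (simp add: theta_pow_def kj)
    moreover have "exp (h * t) * theta_pow j t = exp (t / 2) * theta_pow j (- t)"
      unfolding theta_pow_minus h(3) by (simp add: algebra_simps add_divide_distrib flip: exp_add)
    ultimately have e: "exp (h * t) * theta_pow k t = exp (t / 2) * theta (exp t) * theta_pow j (- t)"
      "exp (h * t) * theta_pow j t = exp (t / 2) * theta_pow j (- t)" by simp_all
    show "theta_reg k (- t) - theta_reg 1 (- t) - exp (h * t) * (theta_pow j t - 1)
      - (indicator {..0} t * exp (h * t) - indicator {..0} t * exp (1 / 2 * t)) = U t"
      unfolding theta_reg_uminus_eq h_def[symmetric] right_diff_distrib e
      by (cases "t < 0"; cases "t = 0") (simp_all add: U_def theta_pow_def algebra_simps)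
  qed
  finally have U: "has_bochner_integral lborel U X" .
  \<comment> \<open>\<open>U\<close> is known to be integrable, so Tonelli gives a summable double
    family. Its inner sum over n is a logarithmic series, with 1/n coming from sqrt (pi /
    a).\<close>
  have "(c has_sum X) (V \<times> {1..})"
  proof (rule has_bochner_integral_has_sum_iff[THEN iffD1, OF _ _ _ _ _ U])
    show "countable (V \<times> {1::nat..})" by (intro countable_SIGMA countableI_type)
    define f where "f = (\<lambda>(v, n) t. exp (- pi * exp (- t) * real (sqnorm v)) *
        (2 * exp (- pi * exp t * (real n)\<^sup>2)) * exp (t / 2))"
    show "has_bochner_integral lborel (f i) (c i)" if i: "i \<in> V \<times> {1..}" for i
    proof -
      obtain v n where vn: "i = (v, n)" "v \<in> V" "n \<ge> 1" using i by auto
      define a where "a = pi * (real n)\<^sup>2"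
      define b where "b = pi * real (sqnorm v)"
      have "sqnorm v \<noteq> 0" using vn sqnorm_eq_0_iff[of v] by (auto simp: V_def)
      then have ab: "0 < a" "0 < b" using vn by (auto simp: a_def b_def)
      have "sqrt (a * b) = sqrt ((pi * real n)\<^sup>2 * real (sqnorm v))"
        by (simp add: a_def b_def power2_eq_square mult_ac)
      also have "\<dots> = pi * real n * int_vec_norm v"
        by (simp only: real_sqrt_mult real_sqrt_abs int_vec_norm_eq) simp
      finally have sq: "- 2 * sqrt (a * b) = real n * (- 2 * pi * int_vec_norm v)" by simp
      have sa: "sqrt (pi / a) = 1 / real n"
        by (simp add: a_def real_sqrt_divide)
      have "has_bochner_integral lborel (\<lambda>t. 2 * (exp (- a * exp t - b * exp (- t)) * exp (t / 2)))
         (2 * (sqrt (pi / a) * exp (- 2 * sqrt (a * b))))"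
        by (intro has_bochner_integral_mult_right has_bochner_integral_bessel_half ab)
      also have "(\<lambda>t. 2 * (exp (- a * exp t - b * exp (- t)) * exp (t / 2))) = f i"
      proof
        fix t
        have "exp (- a * exp t - b * exp (- t)) = exp (- pi * exp (- t) * real (sqnorm v)) * exp (- pi * exp t * (real n)\<^sup>2)"
          by (simp add: a_def b_def algebra_simps flip: exp_add)
        then show "2 * (exp (- a * exp t - b * exp (- t)) * exp (t / 2)) = f i t"
          by (simp add: f_def vn)
      qed
      also have "2 * (sqrt (pi / a) * exp (- 2 * sqrt (a * b))) = c i"
        unfolding sq sa exp_of_nat_mult by (simp add: c_def vn)
      finally show ?thesis .
    qed
    show "0 \<le> f i t" for i t by (auto simp: f_def split: prod.split)
    show "((\<lambda>i. f i t) has_sum U t) (V \<times> {1..})" for t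
    proof -
      have "((\<lambda>(v, n). exp (- pi * exp (- t) * real (sqnorm v)) * (2 * exp (- pi * exp t * (real n)\<^sup>2)))
         has_sum ((theta_pow j (- t) - 1) * (theta (exp t) - 1))) (V \<times> {1..})"
        unfolding V_def
        by (rule has_sum_product_nonneg[OF has_sum_theta_pow_nonzero has_sum_theta_nat]) auto
      from has_sum_cmult_left[OF this, of "exp (t / 2)"] show ?thesis
        by (simp add: f_def U_def case_prod_unfold mult_ac)
    qed
    show "U \<in> borel_measurable lborel" using U by (rule borel_measurable_has_bochner_integral)
  qed
  moreover have "((\<lambda>n. c (v, n)) has_sum (- 2 * ln (1 - exp (- 2 * pi * int_vec_norm v)))) {1..}" if "v \<in> V" for v
  proof -
    have "sqnorm v \<noteq> 0" using that sqnorm_eq_0_iff[of v] by (auto simp: V_def)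
    then have "exp (- 2 * pi * int_vec_norm v) < 1" by (simp add: int_vec_norm_eq)
    from has_sum_cmult_right[OF has_sum_ln_one_minus[OF exp_gt_zero this], of 2] show ?thesis
      by (simp add: c_def)
  qed
  ultimately have "((\<lambda>v. - 2 * ln (1 - exp (- 2 * pi * int_vec_norm v))) has_sum X) V"
    by (rule has_sum_SigmaD)
  then have "ln (Phi k) = - X / 2"
    by (intro ln_Phi) (simp add: V_def j_def)
  then show ?thesis by (simp add: X_def h_def j_def)
qed

section \<open>The constant term of the zeta function at 1\<close>

lemma powr_mean_value:
  fixes x \<delta> :: real
  assumes "0 < x" "0 < \<delta>"
  obtains \<xi> where "x < \<xi>" "\<xi> < x + 1" "(x powr (- \<delta>) - (x + 1) powr (- \<delta>)) / \<delta> = \<xi> powr (- 1 - \<delta>)"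
proof -
  have "\<exists>z>x. z < x + 1 \<and> (x + 1) powr (- \<delta>) - x powr (- \<delta>) = (x + 1 - x) * (- \<delta> * z powr (- \<delta> - 1))"
    using assms by (intro MVT2) (auto intro!: derivative_eq_intros)
  then obtain z where z: "x < z" "z < x + 1"
    "(x + 1) powr (- \<delta>) - x powr (- \<delta>) = - \<delta> * z powr (- \<delta> - 1)" by auto
  have "- \<delta> - 1 = - 1 - \<delta>" by simp
  with z(3) have "x powr (- \<delta>) - (x + 1) powr (- \<delta>) = \<delta> * z powr (- 1 - \<delta>)" by simp
  then have "(x powr (- \<delta>) - (x + 1) powr (- \<delta>)) / \<delta> = z powr (- 1 - \<delta>)"
    using assms by simp
  with z(1,2) show ?thesis using that by blast
qed

text \<open>The difference between (n+1)^(-1-\<delta>) and the integral of x^(-1-\<delta>) over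
  [n+1, n+2]. The integrals telescope to 1/\<delta>, so the sum over n is zeta(1+\<delta>) -
  1/\<delta>.\<close>

definition zeta_diff_term :: "nat \<Rightarrow> real \<Rightarrow> real" where
  "zeta_diff_term n \<delta> = real (Suc n) powr (- 1 - \<delta>)
     - (real (Suc n) powr (- \<delta>) - (real (Suc n) + 1) powr (- \<delta>)) / \<delta>"

text \<open>A bound independent of \<delta>, as Tannery's theorem requires. With r = x / \<xi> in
  (0,1), \<delta> \<le> 1 gives r^(1+\<delta>) \<ge> r^2, and 1 - r^2 \<le> 2 (1 - r) \<le> 2/x; the
  other factor x^(-1-\<delta>) is at most 1/x.\<close>

lemma zeta_diff_term_bound:
  assumes "0 < \<delta>" "\<delta> \<le> 1"
  shows "\<bar>zeta_diff_term n \<delta>\<bar> \<le> 2 / (real (Suc n))\<^sup>2"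
proof -
  define x where "x = real (Suc n)"
  have x: "1 \<le> x" by (simp add: x_def)
  obtain \<xi> where xi: "x < \<xi>" "\<xi> < x + 1" "(x powr (- \<delta>) - (x + 1) powr (- \<delta>)) / \<delta> = \<xi> powr (- 1 - \<delta>)"
    using powr_mean_value[of x \<delta>] x assms by auto
  have "\<xi> powr (- 1 - \<delta>) \<le> x powr (- 1 - \<delta>)"
    using xi x assms by (intro powr_mono2') auto
  moreover have "x powr (- 1 - \<delta>) - \<xi> powr (- 1 - \<delta>) \<le> 2 / x\<^sup>2"
  proof -
    define r where "r = x / \<xi>"
    have r: "0 < r" "r < 1" using x xi by (auto simp: r_def)
    have xir: "\<xi> powr (- 1 - \<delta>) = x powr (- 1 - \<delta>) * r powr (1 + \<delta>)"
      using x xi by (simp add: r_def powr_divide powr_minus_divide powr_diff powr_add field_simps)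
    have "r powr 2 \<le> r powr (1 + \<delta>)"
      using r assms by (intro powr_mono') auto
    then have "r\<^sup>2 \<le> r powr (1 + \<delta>)" using r by simp
    moreover have "1 - r\<^sup>2 \<le> 2 / x"
    proof -
      have "1 - r = (\<xi> - x) / \<xi>" using x xi by (simp add: r_def field_simps)
      also have "\<dots> \<le> 1 / x" using x xi by (intro frac_le) auto
      finally have "1 - r \<le> 1 / x" .
      moreover have "1 - r\<^sup>2 = (1 - r) * (1 + r)" by (simp add: power2_eq_square algebra_simps)
      moreover have "(1 - r) * (1 + r) \<le> (1 - r) * 2" using r by (intro mult_left_mono) auto
      ultimately show ?thesis by simp
    qed
    moreover have "x powr (- 1 - \<delta>) \<le> 1 / x"
      using powr_mono[of "- 1 - \<delta>" "- 1" x] x assms by (simp add: powr_minus_divide)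
    moreover have "r powr (1 + \<delta>) \<le> 1" using r assms by (intro powr_le1) auto
    ultimately have "x powr (- 1 - \<delta>) * (1 - r powr (1 + \<delta>)) \<le> (1 / x) * (2 / x)"
      using x by (intro mult_mono) auto
    then show ?thesis unfolding xir by (simp add: power2_eq_square right_diff_distrib)
  qed
  ultimately show ?thesis
    unfolding zeta_diff_term_def x_def[symmetric] xi(3) by simp
qed

lemma summable_zeta_diff_bound: "summable (\<lambda>n. 2 / (real (Suc n))\<^sup>2)"
  using summable_mult[OF inverse_squares_sums[THEN sums_summable], of 2]
  by (simp add: add.commute)

text \<open>The numerator vanishes at exponent 0, so the limit is its derivative there.\<close>

lemma powr_difference_quotient_tendsto:
  fixes x :: real and \<delta> :: "nat \<Rightarrow> real"
  assumes "0 < x" and d: "\<delta> \<longlonglongrightarrow> 0" "\<And>i. 0 < \<delta> i"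
  shows "(\<lambda>i. (x powr (- \<delta> i) - (x + 1) powr (- \<delta> i)) / \<delta> i) \<longlonglongrightarrow> ln (x + 1) - ln x"
proof -
  have "((\<lambda>h. x powr (- h) - (x + 1) powr (- h)) has_real_derivative (ln (x + 1) - ln x)) (at 0)"
    using assms(1) by (auto intro!: derivative_eq_intros)
  then have "((\<lambda>h. (x powr (- h) - (x + 1) powr (- h)) / h) \<longlongrightarrow> ln (x + 1) - ln x) (at 0)"
    using assms(1) by (simp add: DERIV_def)
  moreover have "filterlim \<delta> (at 0) sequentially"
    using d by (auto simp: filterlim_at intro!: always_eventually) (metis less_irrefl)
  ultimately show ?thesis by (rule filterlim_compose)
qed

lemma zeta_diff_tendsto:
  assumes d: "\<delta> \<longlonglongrightarrow> 0" "\<And>i. 0 < \<delta> i" "\<And>i. \<delta> i \<le> 1"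
  shows "(\<lambda>i. \<Sum>n. zeta_diff_term n (\<delta> i)) \<longlonglongrightarrow> euler_mascheroni"
proof -
  have "(\<lambda>i. \<Sum>n. zeta_diff_term n (\<delta> i)) \<longlonglongrightarrow>
      (\<Sum>n. 1 / real (Suc n) - (ln (real (Suc n) + 1) - ln (real (Suc n))))"
  proof (rule tannerys_theorem[THEN conjunct2, THEN conjunct2])
    show "(\<lambda>i. zeta_diff_term n (\<delta> i)) \<longlonglongrightarrow> 1 / real (Suc n) - (ln (real (Suc n) + 1) - ln (real (Suc n)))" for n
    proof -
      have "(\<lambda>i. real (Suc n) powr (- 1 - \<delta> i)) \<longlonglongrightarrow> real (Suc n) powr (- 1 - 0)"
        by (intro tendsto_intros d) auto
      then have "(\<lambda>i. real (Suc n) powr (- 1 - \<delta> i)) \<longlonglongrightarrow> 1 / real (Suc n)"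
        by (simp add: powr_minus_divide)
      then show ?thesis unfolding zeta_diff_term_def
        by (intro tendsto_diff powr_difference_quotient_tendsto d) auto
    qed
    show "\<forall>\<^sub>F (n, i) in at_top \<times>\<^sub>F sequentially. norm (zeta_diff_term n (\<delta> i)) \<le> 2 / (real (Suc n))\<^sup>2"
      using zeta_diff_term_bound d by (intro always_eventually) auto
  qed (use summable_zeta_diff_bound in auto)
  also have "(\<Sum>n. 1 / real (Suc n) - (ln (real (Suc n) + 1) - ln (real (Suc n)))) = euler_mascheroni"
    using euler_mascheroni_sum_real
    by (intro sums_unique[symmetric]) (simp add: inverse_eq_divide algebra_simps)
  finally show ?thesis .
qed

lemma sums_zeta_diff:
  assumes "0 < \<delta>" "\<delta> \<le> 1"
  shows "(\<lambda>n. real (Suc n) powr (- 1 - \<delta>)) sums ((\<Sum>n. zeta_diff_term n \<delta>) + 1 / \<delta>)"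
proof -
  have "summable (\<lambda>n. zeta_diff_term n \<delta>)"
    using zeta_diff_term_bound[OF assms] by (intro summable_comparison_test[OF _ summable_zeta_diff_bound]) auto
  then have 1: "(\<lambda>n. zeta_diff_term n \<delta>) sums (\<Sum>n. zeta_diff_term n \<delta>)" by (rule summable_sums)
  have "filterlim (\<lambda>n. real (Suc n)) at_top sequentially"
    using filterlim_compose[OF filterlim_real_sequentially filterlim_Suc] .
  then have "(\<lambda>n. real (Suc n) powr (- \<delta>)) \<longlonglongrightarrow> 0"
    using assms by (intro tendsto_neg_powr) auto
  from telescope_sums'[OF this]
  have "(\<lambda>n. real (Suc n) powr (- \<delta>) - real (Suc (Suc n)) powr (- \<delta>)) sums (1 - 0)" by simp
  from sums_add[OF 1 sums_divide[OF this, of \<delta>]] show ?thesis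
    by (simp add: zeta_diff_term_def add.commute)
qed

text \<open>The integral is 2 pi^(-1/2-s) Gamma(1/2+s) zeta(1+2s), with zeta split into its regular
  part and 1/(2s). The bound s \<le> 1/2 keeps 2s in the range of the uniform estimate.\<close>

lemma has_bochner_integral_theta_zeta:
  assumes s: "0 < s" "s \<le> 1 / 2"
  shows "has_bochner_integral lborel (\<lambda>t. exp ((1 / 2 + s) * t) * (theta (exp t) - 1))
     (pi powr (- (1 / 2 + s)) * Gamma (1 / 2 + s) * (2 * (\<Sum>n. zeta_diff_term n (2 * s)) + 1 / s))"
proof -
  define C where "C = pi powr (- (1 / 2 + s)) * Gamma (1 / 2 + s)"
  have "((\<lambda>n. real n powr (- 1 - 2 * s)) has_sum ((\<Sum>n. zeta_diff_term n (2 * s)) + 1 / (2 * s))) {1..}"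
    using sums_zeta_diff[of "2 * s"] s by (intro has_sum_nat_ge_1) auto
  from has_sum_cmult_right[OF this, of "2 * C"]
  have sum: "((\<lambda>n. 2 * C * real n powr (- 1 - 2 * s)) has_sum (C * (2 * (\<Sum>n. zeta_diff_term n (2 * s)) + 1 / s))) {1..}"
    using s by (simp add: algebra_simps)
  have "has_bochner_integral lborel (\<lambda>t. exp ((1 / 2 + s) * t) * (theta (exp t) - 1)) (C * (2 * (\<Sum>n. zeta_diff_term n (2 * s)) + 1 / s))"
  proof (rule has_bochner_integral_has_sum_iff[THEN iffD2, OF _ _ _ _ _ sum])
    show "has_bochner_integral lborel (\<lambda>t. 2 * (exp (- (pi * (real n)\<^sup>2) * exp t) * exp ((1 / 2 + s) * t)))
        (2 * C * real n powr (- 1 - 2 * s))" if "n \<in> {1..}" for n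
    proof -
      have "has_bochner_integral lborel (\<lambda>t. 2 * (exp (- (pi * (real n)\<^sup>2) * exp t) * exp ((1 / 2 + s) * t)))
          (2 * (Gamma (1 / 2 + s) / (pi * (real n)\<^sup>2) powr (1 / 2 + s)))"
        using that s by (intro has_bochner_integral_mult_right has_bochner_integral_Gamma_exp) auto
      also have "(pi * (real n)\<^sup>2) powr (1 / 2 + s) = pi powr (1 / 2 + s) * real n powr (1 + 2 * s)"
      proof -
        have "(real n)\<^sup>2 = real n powr 2" using that by simp
        then have "((real n)\<^sup>2) powr (1 / 2 + s) = real n powr (1 + 2 * s)"
          by (simp only: powr_powr) (simp add: algebra_simps)
        then show ?thesis by (simp add: powr_mult)
      qed
      also have "2 * (Gamma (1 / 2 + s) / (pi powr (1 / 2 + s) * real n powr (1 + 2 * s))) = 2 * C * real n powr (- 1 - 2 * s)"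
      proof -
        have "real n powr (- 1 - 2 * s) = 1 / real n powr (1 + 2 * s)"
          using powr_minus_divide[of "real n" "1 + 2 * s"] by simp
        moreover have "pi powr (- (1 / 2 + s)) = 1 / pi powr (1 / 2 + s)" by (rule powr_minus_divide)
        ultimately show ?thesis by (simp add: C_def)
      qed
      finally show ?thesis .
    qed
    show "((\<lambda>n::nat. 2 * (exp (- (pi * (real n)\<^sup>2) * exp t) * exp ((1 / 2 + s) * t))) has_sum
        exp ((1 / 2 + s) * t) * (theta (exp t) - 1)) {1..}" for t
      using has_sum_cmult_right[OF has_sum_theta_nat[of "exp t"], of "exp ((1 / 2 + s) * t)"]
      by (simp add: mult_ac)
    have "(\<lambda>t. exp ((1 / 2 + s) * t) * (theta (exp t) - 1)) \<in> borel_measurable borel"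
      using continuous_on_theta_exp[of 1] by (intro borel_measurable_continuous_onI continuous_intros) auto
    then show "(\<lambda>t. exp ((1 / 2 + s) * t) * (theta (exp t) - 1)) \<in> borel_measurable lborel" by simp
  qed auto
  then show ?thesis by (simp only: C_def)
qed

text \<open>For s > 0 the two corrections on t \<le> 0 are integrable separately and give 1/(1/2+s)
  - 1/s; the term - 1/s is what cancels the pole of zeta as s tends to 0.\<close>

lemma has_bochner_integral_theta_reg_exp:
  assumes s: "0 < s" "s \<le> 1 / 2"
  shows "has_bochner_integral lborel (\<lambda>t. exp (s * t) * theta_reg 1 (- t))
     (pi powr (- (1 / 2 + s)) * Gamma (1 / 2 + s) * (2 * (\<Sum>n. zeta_diff_term n (2 * s)) + 1 / s)
       + (1 / (1 / 2 + s) - 1 / s))"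
proof -
  have "has_bochner_integral lborel (\<lambda>t. exp ((1 / 2 + s) * t) * (theta (exp t) - 1)
        + (indicator {..0} t * exp ((1 / 2 + s) * t) - indicator {..0} t * exp (s * t)))
     (pi powr (- (1 / 2 + s)) * Gamma (1 / 2 + s) * (2 * (\<Sum>n. zeta_diff_term n (2 * s)) + 1 / s)
       + (1 / (1 / 2 + s) - 1 / s))"
    using s by (intro has_bochner_integral_add has_bochner_integral_diff has_bochner_integral_theta_zeta
        has_bochner_integral_exp_atMost_0) auto
  also have "(\<lambda>t. exp ((1 / 2 + s) * t) * (theta (exp t) - 1)
        + (indicator {..0} t * exp ((1 / 2 + s) * t) - indicator {..0} t * exp (s * t)))
      = (\<lambda>t. exp (s * t) * theta_reg 1 (- t))"
  proof
    fix t
    have "exp ((1 / 2 + s) * t) = exp (s * t) * exp (t / 2)"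
      by (simp add: algebra_simps flip: exp_add)
    then show "exp ((1 / 2 + s) * t) * (theta (exp t) - 1)
        + (indicator {..0} t * exp ((1 / 2 + s) * t) - indicator {..0} t * exp (s * t))
      = exp (s * t) * theta_reg 1 (- t)"
      unfolding theta_reg_uminus_eq
      by (cases "t < 0"; cases "t = 0") (simp_all add: theta_pow_def algebra_simps)
  qed
  finally show ?thesis .
qed

lemma theta_const_1: "theta_const 1 = 2 + euler_mascheroni - ln (4 * pi)"
proof -
  define s where "s = (\<lambda>i::nat. inverse (real (Suc i)) / 2)"
  have s: "0 < s i" "s i \<le> 1 / 2" for i by (auto simp: s_def field_simps)
  have s0: "s \<longlonglongrightarrow> 0" 
    using tendsto_divide[OF LIMSEQ_inverse_real_of_nat tendsto_const, of 2] by (simp add: s_def)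
  have sat: "filterlim s (at 0) sequentially"
    using s0 s(1) by (auto simp: filterlim_at intro!: always_eventually) (metis less_irrefl)
  define V where "V = (\<lambda>s. pi powr (- (1 / 2 + s)) * Gamma (1 / 2 + s) * (2 * (\<Sum>n. zeta_diff_term n (2 * s)) + 1 / s)
       + (1 / (1 / 2 + s) - 1 / s))"
  have int: "has_bochner_integral lborel (\<lambda>t. exp (s i * t) * theta_reg 1 (- t)) (V (s i))" for i
    unfolding V_def by (rule has_bochner_integral_theta_reg_exp) (use s in auto)
  obtain M where M: "0 \<le> M" "\<And>t. 0 \<le> theta_reg 1 t" "\<And>t. theta_reg 1 t \<le> M * exp (- 1 * \<bar>t\<bar>)"
    using theta_reg_bound[of 1] by blast
  have "(\<lambda>i. \<integral>t. exp (s i * t) * theta_reg 1 (- t) \<partial>lborel) \<longlonglongrightarrow> (\<integral>t. theta_reg 1 (- t) \<partial>lborel)"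
  proof (rule integral_dominated_convergence)
    \<comment> \<open>Since s_i \<le> 1/2, the factor e^(s_i t) costs at most half of the decay
      e^(-|t|) of \<open>theta_reg\<close>.\<close>
    show "integrable lborel (\<lambda>t. M * exp (- (1 / 2) * \<bar>t\<bar>))"
      using integrable_exp_abs[of "1 / 2"] by simp
    show "AE t in lborel. (\<lambda>i. exp (s i * t) * theta_reg 1 (- t)) \<longlonglongrightarrow> theta_reg 1 (- t)"
    proof (rule AE_I2)
      fix t
      have "(\<lambda>i. exp (s i * t) * theta_reg 1 (- t)) \<longlonglongrightarrow> exp (0 * t) * theta_reg 1 (- t)"
        by (intro tendsto_intros s0)
      then show "(\<lambda>i. exp (s i * t) * theta_reg 1 (- t)) \<longlonglongrightarrow> theta_reg 1 (- t)" by simp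
    qed
    show "AE t in lborel. norm (exp (s i * t) * theta_reg 1 (- t)) \<le> M * exp (- (1 / 2) * \<bar>t\<bar>)" for i
    proof (rule AE_I2)
      fix t
      have "s i * t \<le> s i * \<bar>t\<bar>" using s[of i] by (intro mult_left_mono) auto
      also have "\<dots> \<le> 1 / 2 * \<bar>t\<bar>" using s[of i] by (intro mult_right_mono) auto
      finally have "exp (s i * t) \<le> exp (1 / 2 * \<bar>t\<bar>)" by simp
      then have "exp (s i * t) * theta_reg 1 (- t) \<le> exp (1 / 2 * \<bar>t\<bar>) * (M * exp (- 1 * \<bar>- t\<bar>))"
        using M(1,2) M(3)[of "- t"] by (intro mult_mono) auto
      also have "\<dots> = M * exp (- (1 / 2) * \<bar>t\<bar>)"
        by (simp add: algebra_simps flip: exp_add)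
      finally show "norm (exp (s i * t) * theta_reg 1 (- t)) \<le> M * exp (- (1 / 2) * \<bar>t\<bar>)"
        using M(2) by simp
    qed
  qed (use int[THEN borel_measurable_has_bochner_integral] in auto)
  moreover have "(\<integral>t. theta_reg 1 (- t) \<partial>lborel) = theta_const 1"
    using has_bochner_integral_lborel_reflect[OF has_bochner_integral_theta_reg, of 1 0]
    by (simp add: has_bochner_integral_iff)
  moreover have "(\<integral>t. exp (s i * t) * theta_reg 1 (- t) \<partial>lborel) = V (s i)" for i
    using int[of i] by (simp add: has_bochner_integral_iff)
  ultimately have lim1: "(\<lambda>i. V (s i)) \<longlonglongrightarrow> theta_const 1" by simp
  define P where "P = (\<lambda>s. pi powr (- (1 / 2 + s)) * Gamma (1 / 2 + s) :: real)"
  have P0: "P 0 = 1"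
    by (simp add: P_def Gamma_one_half_real powr_minus powr_half_sqrt)
  have "(P has_real_derivative (Digamma (1 / 2) - ln pi)) (at 0)"
  proof -
    have "(P has_real_derivative (P 0 * Digamma (1 / 2) - ln pi * P 0)) (at 0)"
      unfolding P_def by (auto intro!: derivative_eq_intros simp: algebra_simps)
    then show ?thesis by (simp add: P0)
  qed
  then have dP: "((\<lambda>h. (P h - 1) / h) \<longlongrightarrow> Digamma (1 / 2) - ln pi) (at 0)"
    and contP: "isCont P 0"
    by (auto simp: DERIV_def P0 intro: DERIV_isCont)
  have "(\<lambda>i. P (s i)) \<longlonglongrightarrow> 1"
    using isCont_tendsto_compose[OF contP s0] P0 by simp
  moreover have "(\<lambda>i. (P (s i) - 1) / s i) \<longlonglongrightarrow> Digamma (1 / 2) - ln pi"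
    by (rule filterlim_compose[OF dP sat])
  moreover have "(\<lambda>i. \<Sum>n. zeta_diff_term n (2 * s i)) \<longlonglongrightarrow> euler_mascheroni"
  proof (rule zeta_diff_tendsto)
    show "(\<lambda>i. 2 * s i) \<longlonglongrightarrow> 0" using tendsto_mult[OF tendsto_const s0, of 2] by simp
    show "0 < 2 * s i" "2 * s i \<le> 1" for i using s[of i] by auto
  qed
  \<comment> \<open>The poles P/s and - 1/s are merged into (P - 1)/s, whose limit is P'(0) because
    P(0) = 1.\<close>
  ultimately have "(\<lambda>i. (P (s i) - 1) / s i + 2 * P (s i) * (\<Sum>n. zeta_diff_term n (2 * s i)) + 1 / (1 / 2 + s i))
     \<longlonglongrightarrow> (Digamma (1 / 2) - ln pi) + 2 * 1 * euler_mascheroni + 1 / (1 / 2 + 0)"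
    by (intro tendsto_intros s0) auto
  also have "(\<lambda>i. (P (s i) - 1) / s i + 2 * P (s i) * (\<Sum>n. zeta_diff_term n (2 * s i)) + 1 / (1 / 2 + s i))
      = (\<lambda>i. V (s i))"
  proof
    fix i
    have V: "V (s i) = P (s i) * (2 * (\<Sum>n. zeta_diff_term n (2 * s i)) + 1 / s i) + (1 / (1 / 2 + s i) - 1 / s i)"
      by (simp only: V_def P_def)
    show "(P (s i) - 1) / s i + 2 * P (s i) * (\<Sum>n. zeta_diff_term n (2 * s i)) + 1 / (1 / 2 + s i) = V (s i)"
      unfolding V by (simp add: ring_distribs diff_divide_distrib)
  qed
  finally have "theta_const 1 = (Digamma (1 / 2) - ln pi) + 2 * 1 * euler_mascheroni + 1 / (1 / 2 + 0)"
    using lim1 LIMSEQ_unique by blast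
  also have "\<dots> = 2 + euler_mascheroni - (2 * ln 2 + ln pi)"
    by (simp add: Digamma_one_half)
  also have "2 * ln 2 + ln pi = ln (4 * pi)"
    using ln_realpow[of 2 2] by (simp add: ln_mult)
  finally show ?thesis .
qed

theorem theorem2:
  fixes k :: nat and \<alpha> \<beta> :: real
  assumes "k \<ge> 1" and "\<alpha> > 0" and "\<beta> > 0" and "\<alpha> * \<beta> = pi ^ 2"
  shows "\<alpha> powr (real k / 2) *
           (2 * eta_sq (k - 1) (real k / 2) + 2 * euler_mascheroni - 4 * ln (Phi k)
            - 2 * ln (4 * \<beta>)
            + 2 * (\<Sum>\<^sub>\<infinity>(m, n) \<in> {1..} \<times> {1..}.
                     real (r_sq k m) * real (r_sq k n) * besselK0 (2 * sqrt (real (m * n)) * \<alpha>)))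
       = \<beta> powr (real k / 2) *
           (2 * eta_sq (k - 1) (real k / 2) + 2 * euler_mascheroni - 4 * ln (Phi k)
            - 2 * ln (4 * \<alpha>)
            + 2 * (\<Sum>\<^sub>\<infinity>(m, n) \<in> {1..} \<times> {1..}.
                     real (r_sq k m) * real (r_sq k n) * besselK0 (2 * sqrt (real (m * n)) * \<beta>)))"
proof -
  define l where "l = ln (\<alpha> / pi)"
  have \<alpha>: "\<alpha> = pi * exp l" using assms(2) by (simp add: l_def)
  have "\<beta> = pi\<^sup>2 / \<alpha>" using assms by (simp add: field_simps)
  then have \<beta>: "\<beta> = pi * exp (- l)" by (simp add: \<alpha> exp_minus power2_eq_square field_simps)
  \<comment> \<open>As ln (4 \<beta>) = ln (4 pi) - l, the logarithms of 4 pi cancel and the left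
    bracket becomes 2 E + 2 l + \<open>theta_conv k l\<close>; the right one is the same with -
    l.\<close>
  define E where "E = theta_const k - 2 / real k"
  have E: "2 * eta_sq (k - 1) (real k / 2) + 2 * euler_mascheroni - 4 * ln (Phi k) = 2 * E + 2 * ln (4 * pi)"
    using kronecker_limit_theta_const[OF assms(1)] theta_const_1 by (simp add: E_def)
  have ln4: "ln (4 * (pi * exp x)) = ln (4 * pi) + x" for x :: real
    using ln_mult[of "4 * pi" "exp x"] by (simp add: mult.assoc)
  \<comment> \<open>\<open>bessel_double_sum\<close> includes summability, so \<open>infsum\<close>
    does not take its default value 0.\<close>
  have sum: "(\<Sum>\<^sub>\<infinity>(m, n) \<in> {1..} \<times> {1..}. real (r_sq k m) * real (r_sq k n)
      * besselK0 (2 * sqrt (real (m * n)) * (pi * exp x))) = theta_conv k x / 2" for x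
    by (rule infsumI) (rule bessel_double_sum)
  have pow: "(pi * exp x) powr (real k / 2) = pi powr (real k / 2) * exp (real k / 2 * x)" for x :: real
    by (simp add: powr_def ln_mult algebra_simps flip: exp_add)
  \<comment> \<open>The factor e^(-k l) of the reflection is shared evenly between the two sides, as
    the powers of \<alpha> and \<beta> demand.\<close>
  have "exp (real k / 2 * l) * exp (- real k * l) = exp (real k / 2 * - l)"
    by (simp add: algebra_simps flip: exp_add)
  then have "exp (real k / 2 * l) * (theta_conv k l + 2 * E + 2 * l)
      = exp (real k / 2 * - l) * (theta_conv k (- l) + 2 * E - 2 * l)"
    using theta_conv_reflect[OF assms(1), of l] unfolding E_def[symmetric] by (simp flip: mult.assoc)
  from arg_cong[OF this, of "\<lambda>x. pi powr (real k / 2) * x"] show ?thesis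
    unfolding \<alpha> \<beta> E sum ln4 pow by (simp add: algebra_simps)
qed

end
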